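(* Let $[x_k]=(x_0,\dots,x_N)$ be a zero-mean Gaussian sequence of $\mathbb{R}^d$-valued vectors. Consider the model, for $c\in\{0,N\}$, $$x_k=G_{k,k-1}x_{k-1}+G_{k,c}x_c+e_k,\quad k\in[1,N]\setminus\{c\},\qquad x_c=e_c,\qquad x_0=G_{0,c}x_c+e_0\ (\text{last equation only for }c=N),\qquad (1)$$ where $[e_k]=(e_0,\dots,e_N)$ is a zero-mean white Gaussian sequence with $G_k=\mathrm{Cov}(e_k)$ and the $G_{k,k-1},G_{k,c}$ (and $G_{0,N}$ for $c=N$) are $d\times d$ matrices, and the equation $$P_{k,i}=\begin{bmatrix} P_{k,j} & P_{k,l}\end{bmatrix}\begin{bmatrix} P_j & P_{j,l}\\ P_{l,j} & P_l\end{bmatrix}^{+}\begin{bmatrix} P_{j,i}\\ P_{l,i}\end{bmatrix},\qquad (2)$$ where $P=\mathcal{G}^{-1}G(\mathcal{G}')^{-1}$, $G=\mathrm{diag}(G_0,\dots,G_N)$, and $\mathcal{G}$ is the block matrix $\mathcal{G}^{(c)}$ formed from the parameters of (1), defined in the context. Then $[x_k]$ is reciprocal if and only if (i) it obeys (1) with $c=N$ for some choice of parameters and $[e_k]$ such that (2) holds, with $\mathcal{G}=\mathcal{G}^{(N)}$, for all $i,j,k,l\in[0,N]$ with $l<i<j<k$; or, equivalently, if and only if (ii) it obeys (1) with $c=0$ for some choice of parameters and $[e_k]$ such that (2) holds, with $\mathcal{G}=\mathcal{G}^{(0)}$, for all $i,j,k,l\in[0,N]$ with $i<j<k<l$.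
   Context: Sequences are indexed by discrete time $[0,N]=(0,1,\dots,N)$; $[x_k]_i^j=(x_i,\dots,x_j)$; the prime denotes transpose and the superscript $+$ the Moore–Penrose inverse. For a block matrix $P$ with $d\times d$ blocks indexed by $0,\dots,N$, $P_{i,j}$ is the block in block row $i$, block column $j$, and $P_i=P_{i,i}$. The $(N+1)\times(N+1)$ block matrices $\mathcal{G}^{(c)}$ (so that the model reads $\mathcal{G}^{(c)}[x_0',\dots,x_N']'=[e_0',\dots,e_N']'$) are: for $c=N$, $\mathcal{G}^{(N)}_{k,k}=I$ for $k\in[0,N]$, $\mathcal{G}^{(N)}_{k,k-1}=-G_{k,k-1}$ for $k\in[1,N-1]$, $\mathcal{G}^{(N)}_{k,N}=-G_{k,N}$ for $k\in[0,N-1]$, all other blocks $0$; for $c=0$, $\mathcal{G}^{(0)}_{k,k}=I$ for $k\in[0,N]$, $\mathcal{G}^{(0)}_{1,0}=-2G_{1,0}$, $\mathcal{G}^{(0)}_{k,0}=-G_{k,0}$ and $\mathcal{G}^{(0)}_{k,k-1}=-G_{k,k-1}$ for $k\in[2,N]$, all other blocks $0$. Gaussian sequences are jointly Gaussian, with possibly singular covariance; a white Gaussian sequence is a jointly Gaussian sequence with $e_k,e_j$ uncorrelated for $k\ne j$ (covariances possibly singular). Equations between random vectors hold almost surely. $[x_k]$ is reciprocal iff conditioned on the states at any two times $j<l$, the segment inside $(j,l)$ is independent of the two segments outside $[j,l]$; equivalently, $F(\xi_k|[x_i]_0^j,[x_i]_l^N)=F(\xi_k|x_j,x_l)$ (a.s.)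 for all $j<k<l$ in $[0,N]$ and all $\xi_k\in\mathbb{R}^d$, where $F(\cdot|\cdot)$ is the conditional CDF. *)

theory Defs
  imports "HOL-Probability.Probability"
begin

section \<open>Matrices\<close>

text \<open>
  The Moore--Penrose inverse, characterised by the four Penrose equations (over the reals exactly
  one matrix satisfies them).
\<close>

definition pinv :: "real^'n^'m \<Rightarrow> real^'m^'n" where
  "pinv A = (THE X. A ** X ** A = A \<and> X ** A ** X = X \<and>
                    transpose (A ** X) = A ** X \<and> transpose (X ** A) = X ** A)"

definition hcat :: "real^'n^'m \<Rightarrow> real^'p^'m \<Rightarrow> real^('n + 'p)^'m" where
  "hcat A B = (\<chi> r c. case c of Inl c1 \<Rightarrow> A $ r $ c1 | Inr c2 \<Rightarrow> B $ r $ c2)"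

definition vcat :: "real^'n^'m \<Rightarrow> real^'n^'q \<Rightarrow> real^'n^('m + 'q)" where
  "vcat A C = (\<chi> r. case r of Inl r1 \<Rightarrow> A $ r1 | Inr r2 \<Rightarrow> C $ r2)"

text \<open>
  An \<open>(N+1) \<times> (N+1)\<close> block matrix with \<open>d \<times> d\<close> blocks is a function from the block row and the
  block column to the block. Blocks with an index greater than \<open>N\<close> are zero by convention, so that
  each such matrix is represented by exactly one function.
\<close>

type_synonym 'd bmat = "nat \<Rightarrow> nat \<Rightarrow> real^'d^'d"

definition bmat_carrier :: "nat \<Rightarrow> ('d::finite) bmat set" where
  "bmat_carrier N = {A. \<forall>i j. i > N \<or> j > N \<longrightarrow> A i j = 0}"

definition bmult :: "nat \<Rightarrow> ('d::finite) bmat \<Rightarrow> 'd bmat \<Rightarrow> 'd bmat" where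
  "bmult N A B = (\<lambda>i j. if i \<le> N \<and> j \<le> N then (\<Sum>k\<le>N. A i k ** B k j) else 0)"

definition btranspose :: "('d::finite) bmat \<Rightarrow> 'd bmat" where
  "btranspose A = (\<lambda>i j. transpose (A j i))"

definition bdiag :: "nat \<Rightarrow> (nat \<Rightarrow> real^'d^'d) \<Rightarrow> ('d::finite) bmat" where
  "bdiag N D = (\<lambda>i j. if i = j \<and> i \<le> N then D i else 0)"

definition bone :: "nat \<Rightarrow> ('d::finite) bmat" where
  "bone N = bdiag N (\<lambda>_. mat 1)"

definition binv :: "nat \<Rightarrow> ('d::finite) bmat \<Rightarrow> 'd bmat" where
  "binv N A = (THE B. B \<in> bmat_carrier N \<and> bmult N A B = bone N \<and> bmult N B A = bone N)"


section \<open>Gaussian sequences\<close>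

text \<open>A real Gaussian random variable, point masses included.\<close>

definition gaussian_rv :: "'a measure \<Rightarrow> ('a \<Rightarrow> real) \<Rightarrow> bool" where
  "gaussian_rv M Y \<longleftrightarrow> Y \<in> borel_measurable M \<and>
     (\<exists>\<mu> \<sigma>. (\<sigma> = 0 \<and> (AE \<omega> in M. Y \<omega> = \<mu>)) \<or>
            (\<sigma> > 0 \<and> distributed M lborel Y (normal_density \<mu> \<sigma>)))"

text \<open>
  Joint Gaussianity of \<open>x\<^sub>0, \<dots>, x\<^sub>N\<close>, with possibly singular covariance: every linear combination
  of the entries is a (possibly degenerate) Gaussian random variable.
\<close>

definition zero_mean_gaussian_seq ::
  "'a measure \<Rightarrow> nat \<Rightarrow> (nat \<Rightarrow> 'a \<Rightarrow> real^'d) \<Rightarrow> bool" where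
  "zero_mean_gaussian_seq M N x \<longleftrightarrow>
     (\<forall>k\<le>N. x k \<in> borel_measurable M) \<and>
     (\<forall>a :: nat \<Rightarrow> real^'d. gaussian_rv M (\<lambda>\<omega>. \<Sum>k\<le>N. a k \<bullet> x k \<omega>)) \<and>
     (\<forall>k\<le>N. integral\<^sup>L M (x k) = 0)"

definition cov_mat ::
  "'a measure \<Rightarrow> ('a \<Rightarrow> real^'d) \<Rightarrow> ('a \<Rightarrow> real^'d) \<Rightarrow> real^'d^'d" where
  "cov_mat M X Y =
     (\<chi> r s. integral\<^sup>L M (\<lambda>\<omega>. (X \<omega> - integral\<^sup>L M X) $ r * (Y \<omega> - integral\<^sup>L M Y) $ s))"

definition zero_mean_white_gaussian_seq ::
  "'a measure \<Rightarrow> nat \<Rightarrow> (nat \<Rightarrow> 'a \<Rightarrow> real^'d) \<Rightarrow> bool" where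
  "zero_mean_white_gaussian_seq M N e \<longleftrightarrow>
     zero_mean_gaussian_seq M N e \<and>
     (\<forall>k\<le>N. \<forall>j\<le>N. k \<noteq> j \<longrightarrow> cov_mat M (e k) (e j) = 0)"


section \<open>Reciprocal sequences\<close>

text \<open>The sigma-algebra generated by the states \<open>x\<^sub>i\<close>, \<open>i \<in> I\<close>.\<close>

definition gen_sigma ::
  "'a measure \<Rightarrow> (nat \<Rightarrow> 'a \<Rightarrow> real^'d) \<Rightarrow> nat set \<Rightarrow> 'a measure" where
  "gen_sigma M x I =
     vimage_algebra (space M) (\<lambda>\<omega>. \<lambda>i\<in>I. x i \<omega>) (\<Pi>\<^sub>M i\<in>I. (borel :: (real^'d) measure))"

text \<open>Conditional independence of the sigma-algebras \<open>H\<close> and \<open>K\<close> given \<open>F\<close>.\<close>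

definition cond_indep :: "'a measure \<Rightarrow> 'a measure \<Rightarrow> 'a measure \<Rightarrow> 'a measure \<Rightarrow> bool" where
  "cond_indep M F H K \<longleftrightarrow>
     (\<forall>A\<in>sets H. \<forall>B\<in>sets K. AE \<omega> in M.
        real_cond_exp M F (indicator (A \<inter> B)) \<omega> =
        real_cond_exp M F (indicator A) \<omega> * real_cond_exp M F (indicator B) \<omega>)"

definition reciprocal :: "'a measure \<Rightarrow> nat \<Rightarrow> (nat \<Rightarrow> 'a \<Rightarrow> real^'d) \<Rightarrow> bool" where
  "reciprocal M N x \<longleftrightarrow>
     (\<forall>j l. j < l \<and> l \<le> N \<longrightarrow>
        cond_indep M (gen_sigma M x {j, l})
          (gen_sigma M x {j<..<l}) (gen_sigma M x ({..<j} \<union> {l<..N})))"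


section \<open>The model\<close>

text \<open>
  \<open>G k m\<close> is the coefficient of \<open>x\<^sub>m\<close> in the equation for \<open>x\<^sub>k\<close>. For \<open>c = 0\<close> and \<open>k = 1\<close> the two
  coefficients \<open>G\<^sub>k\<^sub>,\<^sub>k\<^sub>-\<^sub>1\<close> and \<open>G\<^sub>k\<^sub>,\<^sub>c\<close> are the same matrix \<open>G\<^sub>1\<^sub>,\<^sub>0\<close>, and the equation reads
  \<open>x\<^sub>1 = 2 G\<^sub>1\<^sub>,\<^sub>0 x\<^sub>0 + e\<^sub>1\<close>; hence the factor 2 in the matrix below.
\<close>

definition obeys_model ::
  "'a measure \<Rightarrow> nat \<Rightarrow> nat \<Rightarrow> ('d::finite) bmat \<Rightarrow>
   (nat \<Rightarrow> 'a \<Rightarrow> real^'d) \<Rightarrow> (nat \<Rightarrow> 'a \<Rightarrow> real^'d) \<Rightarrow> bool" where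
  "obeys_model M N c G e x \<longleftrightarrow>
     (\<forall>k\<in>{1..N} - {c}. AE \<omega> in M. x k \<omega> = G k (k - 1) *v x (k - 1) \<omega> + G k c *v x c \<omega> + e k \<omega>) \<and>
     (AE \<omega> in M. x c \<omega> = e c \<omega>) \<and>
     (c = N \<longrightarrow> (AE \<omega> in M. x 0 \<omega> = G 0 c *v x c \<omega> + e 0 \<omega>))"

definition model_mat_last :: "nat \<Rightarrow> ('d::finite) bmat \<Rightarrow> 'd bmat" where
  "model_mat_last N G = (\<lambda>k j.
     if k > N \<or> j > N then 0
     else if j = k then mat 1
     else if 1 \<le> k \<and> k < N \<and> j = k - 1 then - G k (k - 1)
     else if k < N \<and> j = N then - G k N
     else 0)"

definition model_mat_first :: "nat \<Rightarrow> ('d::finite) bmat \<Rightarrow> 'd bmat" where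
  "model_mat_first N G = (\<lambda>k j.
     if k > N \<or> j > N then 0
     else if j = k then mat 1
     else if k = 1 \<and> j = 0 then - (2 *\<^sub>R G 1 0)
     else if 2 \<le> k \<and> j = 0 then - G k 0
     else if 2 \<le> k \<and> j = k - 1 then - G k (k - 1)
     else 0)"

definition model_cov ::
  "'a measure \<Rightarrow> nat \<Rightarrow> ('d::finite) bmat \<Rightarrow> (nat \<Rightarrow> 'a \<Rightarrow> real^'d) \<Rightarrow> 'd bmat" where
  "model_cov M N A e =
     bmult N (bmult N (binv N A) (bdiag N (\<lambda>k. cov_mat M (e k) (e k)))) (binv N (btranspose A))"

definition cov_condition :: "('d::finite) bmat \<Rightarrow> nat \<Rightarrow> nat \<Rightarrow> nat \<Rightarrow> nat \<Rightarrow> bool" where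
  "cov_condition P i j k l \<longleftrightarrow>
     P k i = hcat (P k j) (P k l) **
             pinv (vcat (hcat (P j j) (P j l)) (hcat (P l j) (P l l))) **
             vcat (P j i) (P l i)"

end

theory Submission
  imports Defs
begin

text \<open>
  For a Gaussian sequence everything is decided by the covariances \<open>P i j\<close>. Say that \<open>x i\<close> and \<open>x m\<close> are
  orthogonal given \<open>(x j, x l)\<close> if the residual of the linear projection of \<open>x i\<close> on \<open>(x j, x l)\<close> is
  uncorrelated with \<open>x m\<close>; the equation with the Moore--Penrose inverse says exactly this. Uniqueness of
  characteristic functions turns orthogonality of residuals into conditional independence and back,
  so that \<open>x\<close> is reciprocal iff \<open>x i\<close> and \<open>x m\<close> are orthogonal given \<open>(x j, x l)\<close> whenever \<open>j < i < l\<close> and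
  \<open>m\<close> lies outside \<open>[j, l]\<close>. The model with \<open>c = N\<close> says that \<open>x k\<close>, given \<open>(x (k-1), x N)\<close>, is orthogonal to
  the past, which is the special case \<open>l = N\<close>, \<open>m < j\<close>; the covariance condition is the case \<open>m > l\<close>.
  The remaining case \<open>m < j\<close>, \<open>l < N\<close> follows by writing \<open>x m\<close> as a combination of \<open>x j\<close> and \<open>x N\<close> plus a part
  that is uncorrelated with \<open>x j, \<dots>, x N\<close>. The model with \<open>c = 0\<close> is treated in the mirrored way.
\<close>

section \<open>Moore--Penrose inverses and block matrices\<close>

definition penrose :: "real^'n^'m \<Rightarrow> real^'m^'n \<Rightarrow> bool" where
  "penrose A X \<longleftrightarrow> A ** X ** A = A \<and> X ** A ** X = X \<and>
                    transpose (A ** X) = A ** X \<and> transpose (X ** A) = X ** A"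

lemma penrose_unique:
  assumes X: "penrose A X" and Y: "penrose A Y"
  shows "X = Y"
proof -
  have "(A ** Y) ** (A ** X) = transpose ((A ** X) ** (A ** Y))"
    using X Y by (simp add: matrix_transpose_mul penrose_def)
  also have "(A ** X) ** (A ** Y) = A ** Y"
    using X by (metis matrix_mul_assoc penrose_def)
  finally have 1: "A ** X = A ** Y"
    using X Y by (metis matrix_mul_assoc penrose_def)
  have "(X ** A) ** (Y ** A) = transpose ((Y ** A) ** (X ** A))"
    using X Y by (simp add: matrix_transpose_mul penrose_def)
  also have "(Y ** A) ** (X ** A) = Y ** A"
    using X by (metis matrix_mul_assoc penrose_def)
  finally have 2: "X ** A = Y ** A"
    using X Y by (metis matrix_mul_assoc penrose_def)
  show ?thesis
    using 1 2 X Y by (metis matrix_mul_assoc penrose_def)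
qed

lemma symmetric_normal_equation:
  fixes A :: "real^'n^'n"
  assumes sym: "transpose A = A"
  obtains Y where "A ** A ** Y = A"
proof -
  have "\<exists>u. A *v (A *v u) = A *v y" for y
  proof -
    obtain p q where p: "p \<in> span (range (\<lambda>u. A *v u))"
      and q: "\<And>w. w \<in> span (range (\<lambda>u. A *v u)) \<Longrightarrow> orthogonal q w" and y: "y = p + q"
      using orthogonal_subspace_decomp_exists by metis
    have "subspace (range (\<lambda>u. A *v u))"
      by (intro linear_subspace_image) auto
    then obtain u where u: "p = A *v u"
      using p by (metis imageE span_eq_iff)
    have "(A *v q) \<bullet> (A *v q) = q \<bullet> (A *v (A *v q))"
      using sym by (metis dot_lmul_matrix vector_transpose_matrix)
    also have "\<dots> = 0"
      using q by (auto simp: orthogonal_def intro: span_base)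
    finally have "A *v q = 0" by simp
    then show ?thesis
      using u y by (auto simp: matrix_vector_right_distrib)
  qed
  then obtain f where f: "\<And>y. A *v (A *v f y) = A *v y" by metis
  define Y where "Y = (\<chi> r c. f (axis c 1) $ r)"
  have col: "Y *v axis c 1 = f (axis c 1)" for c
    by (simp add: Y_def matrix_vector_mul_component vec_eq_iff matrix_vector_mult_basis column_def)
  have "A ** A ** Y = A"
  proof -
    have "(A ** A ** Y) *v axis c 1 = A *v axis c 1" for c
      by (simp only: matrix_vector_mul_assoc[symmetric] col f)
    then have "column c (A ** A ** Y) = column c A" for c
      by (simp only: matrix_vector_mult_basis)
    then show ?thesis
      by (simp add: column_def vec_eq_iff)
  qed
  then show ?thesis ..
qed

lemma penrose_symmetric_exists:
  fixes A :: "real^'n^'n"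
  assumes sym: "transpose A = A"
  shows "\<exists>X. penrose A X"
proof -
  obtain Y where Y: "A ** A ** Y = A"
    using symmetric_normal_equation[OF sym] .
  then have Y': "transpose Y ** A ** A = A"
    using sym by (metis matrix_mul_assoc matrix_transpose_mul)
  have c: "transpose Y ** A = A ** Y"
    using Y Y' by (metis matrix_mul_assoc)
  have AYA: "A ** Y ** A = A"
    using c Y' by (metis matrix_mul_assoc)
  have AYA': "A ** transpose Y ** A = A"
    using c Y by (metis matrix_mul_assoc)
  have "penrose A (transpose Y ** A ** Y)"
    unfolding penrose_def
  proof (intro conjI)
    have AX: "A ** (transpose Y ** A ** Y) = A ** Y"
      using AYA' by (metis matrix_mul_assoc)
    have XA: "(transpose Y ** A ** Y) ** A = transpose Y ** A"
      using AYA by (metis matrix_mul_assoc)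
    show "A ** (transpose Y ** A ** Y) ** A = A"
      using AX AYA by simp
    show "transpose Y ** A ** Y ** A ** (transpose Y ** A ** Y) = transpose Y ** A ** Y"
      using AYA AYA' by (metis matrix_mul_assoc)
    show "transpose (A ** (transpose Y ** A ** Y)) = A ** (transpose Y ** A ** Y)"
      using AX c sym by (simp add: matrix_transpose_mul)
    show "transpose (transpose Y ** A ** Y ** A) = transpose Y ** A ** Y ** A"
      using XA c sym by (simp add: matrix_transpose_mul)
  qed
  then show ?thesis ..
qed

lemma pinv_symmetric:
  fixes A :: "real^'n^'n"
  assumes "transpose A = A"
  shows "A ** pinv A ** A = A"
proof -
  obtain X where X: "penrose A X"
    using penrose_symmetric_exists[OF assms] ..
  have "pinv A = X"
    unfolding pinv_def penrose_def[symmetric] using X penrose_unique by blast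
  then show ?thesis
    using X by (simp add: penrose_def)
qed

lemma matrix_mult_add_left: "(A + B) ** (C :: real^'n^'m) = A ** C + B ** C"
  by (simp add: matrix_matrix_mult_def vec_eq_iff distrib_right sum.distrib)

lemma matrix_mult_sum_left: "sum f S ** (B :: real^'n^'m) = (\<Sum>k\<in>S. f k ** B)"
  by (induction S rule: infinite_finite_induct)
     (simp_all add: matrix_mult_add_left times0_left)

lemma matrix_mult_sum_right: "(A :: real^'n^'m) ** sum f S = (\<Sum>k\<in>S. A ** f k)"
  by (induction S rule: infinite_finite_induct)
     (simp_all add: matrix_add_ldistrib times0_right)

lemma transpose_zero [simp]: "transpose (0 :: real^'n^'m) = 0"
  by (simp add: transpose_def vec_eq_iff)

lemma transpose_add: "transpose (A + B :: real^'n^'m) = transpose A + transpose B"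
  by (simp add: transpose_def vec_eq_iff)

lemma transpose_sum: "transpose (sum f S :: real^'n^'m) = (\<Sum>k\<in>S. transpose (f k))"
  by (induction S rule: infinite_finite_induct) (simp_all add: transpose_add)

lemma bmult_assoc: "bmult N (bmult N A B) C = bmult N A (bmult N B C)"
proof (intro ext)
  fix i j
  have "(\<Sum>k\<le>N. (\<Sum>m\<le>N. A i m ** B m k) ** C k j) = (\<Sum>k\<le>N. \<Sum>m\<le>N. A i m ** (B m k ** C k j))"
    by (simp add: matrix_mult_sum_left matrix_mul_assoc)
  also have "\<dots> = (\<Sum>m\<le>N. A i m ** (\<Sum>k\<le>N. B m k ** C k j))"
    by (subst sum.swap) (simp add: matrix_mult_sum_right)
  finally show "bmult N (bmult N A B) C i j = bmult N A (bmult N B C) i j"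
    by (simp add: bmult_def)
qed

lemma bmult_in_carrier [simp]: "bmult N A B \<in> bmat_carrier N"
  by (auto simp: bmult_def bmat_carrier_def)

lemma bone_in_carrier [simp]: "bone N \<in> bmat_carrier N"
  by (auto simp: bone_def bdiag_def bmat_carrier_def)

lemma bmult_bone_left: "A \<in> bmat_carrier N \<Longrightarrow> bmult N (bone N) A = A"
  by (intro ext)
     (auto simp: bmult_def bone_def bdiag_def bmat_carrier_def if_distrib[of "\<lambda>X. X ** _"]
           times0_left sum.delta cong: if_cong)

lemma bmult_bone_right: "A \<in> bmat_carrier N \<Longrightarrow> bmult N A (bone N) = A"
  by (intro ext)
     (auto simp: bmult_def bone_def bdiag_def bmat_carrier_def if_distrib[of "\<lambda>X. _ ** X"]
           times0_right sum.delta' conj_commute cong: if_cong)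

lemma btranspose_bmult: "btranspose (bmult N A B) = bmult N (btranspose B) (btranspose A)"
  by (intro ext) (auto simp: btranspose_def bmult_def transpose_sum matrix_transpose_mul)

lemma btranspose_bone: "btranspose (bone N) = bone N"
  by (intro ext) (auto simp: btranspose_def bone_def bdiag_def transpose_mat)

lemma btranspose_in_carrier: "A \<in> bmat_carrier N \<Longrightarrow> btranspose A \<in> bmat_carrier N"
  by (auto simp: btranspose_def bmat_carrier_def)

lemma binv_eqI:
  assumes "B \<in> bmat_carrier N" "bmult N A B = bone N" "bmult N B A = bone N"
  shows "binv N A = B"
  unfolding binv_def
proof (rule the_equality)
  fix C assume C: "C \<in> bmat_carrier N \<and> bmult N A C = bone N \<and> bmult N C A = bone N"
  have "C = bmult N C (bmult N A B)"
    using C assms by (simp add: bmult_bone_right)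
  also have "\<dots> = bmult N (bmult N C A) B"
    by (simp only: bmult_assoc)
  finally have "C = bmult N (bmult N C A) B" .
  then show "C = B"
    using C assms by (simp add: bmult_bone_left)
qed (use assms in blast)

text \<open>
  Triangular after sorting the block indices by \<open>\<rho>\<close>: the order is \<open>N, 0, \<dots>, N - 1\<close> for the model with
  \<open>c = N\<close>, and the usual one for \<open>c = 0\<close>.
\<close>

definition block_unitriangular :: "nat \<Rightarrow> (nat \<Rightarrow> nat) \<Rightarrow> ('d::finite) bmat \<Rightarrow> bool" where
  "block_unitriangular N \<rho> A \<longleftrightarrow> A \<in> bmat_carrier N \<and> (\<forall>k\<le>N. A k k = mat 1) \<and>
     (\<forall>k\<le>N. \<forall>j\<le>N. j \<noteq> k \<and> A k j \<noteq> 0 \<longrightarrow> \<rho> j < \<rho> k)"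

lemma bmult_unitriangular:
  assumes "block_unitriangular N \<rho> A" "k \<le> N" "j \<le> N"
  shows "bmult N A V k j = V k j + (\<Sum>m | m \<le> N \<and> \<rho> m < \<rho> k. A k m ** V m j)"
proof -
  have "(\<Sum>m\<le>N. A k m ** V m j) = A k k ** V k j + (\<Sum>m\<in>{..N} - {k}. A k m ** V m j)"
    using assms by (simp add: sum.remove)
  also have "(\<Sum>m\<in>{..N} - {k}. A k m ** V m j) = (\<Sum>m | m \<le> N \<and> \<rho> m < \<rho> k. A k m ** V m j)"
    using assms times0_left by (intro sum.mono_neutral_right) (fastforce simp: block_unitriangular_def)+
  finally show ?thesis
    using assms by (simp add: bmult_def block_unitriangular_def)
qed

lemma bmult_unitriangular_cancel:
  assumes A: "block_unitriangular N \<rho> A" and eq: "bmult N A V = bmult N A W"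
    and V: "V \<in> bmat_carrier N" and W: "W \<in> bmat_carrier N"
  shows "V = W"
proof -
  have "V k j = W k j" if "k \<le> N" "j \<le> N" for k j
    using that
  proof (induction "\<rho> k" arbitrary: k rule: less_induct)
    case less
    have "(\<Sum>m | m \<le> N \<and> \<rho> m < \<rho> k. A k m ** V m j) = (\<Sum>m | m \<le> N \<and> \<rho> m < \<rho> k. A k m ** W m j)"
      using less by (intro sum.cong) auto
    then show ?case
      using bmult_unitriangular[OF A less(2,3), of V] bmult_unitriangular[OF A less(2,3), of W] eq
      by simp
  qed
  then show ?thesis
    using V W by (intro ext) (metis (mono_tags, lifting) bmat_carrier_def linorder_not_le mem_Collect_eq)
qed

lemma block_unitriangular_inverse:
  assumes A: "block_unitriangular N \<rho> A"
  obtains B where "B \<in> bmat_carrier N" "bmult N A B = bone N" "bmult N B A = bone N"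
proof -
  have carrier: "A \<in> bmat_carrier N"
    using A by (simp add: block_unitriangular_def)
  define step where "step B k = (\<lambda>j. if k \<le> N \<and> j \<le> N
       then bone N k j - (\<Sum>m | m \<le> N \<and> \<rho> m < \<rho> k. A k m ** B m j) else 0)" for B k
  have "\<exists>B. \<forall>k. B k = step B k"
  proof (rule dependent_wf_choice[where R = "inv_image less_than \<rho>"])
    show "(r = step f x) = (r = step g x)" if "\<And>z. (z, x) \<in> inv_image less_than \<rho> \<Longrightarrow> f z = g z" for f g x r
    proof -
      have "step f x = step g x"
        unfolding step_def using that by (intro ext) (auto intro!: sum.cong)
      then show ?thesis by simp
    qed
  qed auto
  then obtain B where B: "\<And>k. B k = step B k" by blast
  have B_carrier: "B \<in> bmat_carrier N"
    unfolding bmat_carrier_def by (auto simp: B[unfolded step_def])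
  have AB: "bmult N A B = bone N"
  proof (intro ext)
    fix k j
    show "bmult N A B k j = bone N k j"
    proof (cases "k \<le> N \<and> j \<le> N")
      case True
      have "B k j = bone N k j - (\<Sum>m | m \<le> N \<and> \<rho> m < \<rho> k. A k m ** B m j)"
        using B[of k] True by (metis (no_types, lifting) step_def)
      then show ?thesis
        using bmult_unitriangular[OF A, of k j B] True by simp
    qed (auto simp: bmult_def bone_def bdiag_def)
  qed
  have "bmult N A (bmult N B A) = bmult N A (bone N)"
    using AB carrier by (simp add: bmult_bone_left bmult_bone_right flip: bmult_assoc)
  then have "bmult N B A = bone N"
    using bmult_unitriangular_cancel[OF A] by simp
  with B_carrier AB show ?thesis ..
qed

lemma binv_congruence:
  assumes A: "block_unitriangular N \<rho> A" and P: "P \<in> bmat_carrier N"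
    and D: "bmult N (bmult N A P) (btranspose A) = D"
  shows "bmult N (bmult N (binv N A) D) (binv N (btranspose A)) = P"
proof -
  obtain B where B: "B \<in> bmat_carrier N" "bmult N A B = bone N" "bmult N B A = bone N"
    using block_unitriangular_inverse[OF A] .
  have B': "bmult N (btranspose A) (btranspose B) = bone N"
    "bmult N (btranspose B) (btranspose A) = bone N"
    using B by (simp_all add: btranspose_bone flip: btranspose_bmult)
  have "binv N A = B" "binv N (btranspose A) = btranspose B"
    using B B' by (auto intro!: binv_eqI btranspose_in_carrier)
  moreover have "bmult N (bmult N B (bmult N (bmult N A P) (btranspose A))) (btranspose B) =
      bmult N (bmult N (bmult N B A) P) (bmult N (btranspose A) (btranspose B))"
    by (simp add: bmult_assoc)
  ultimately show ?thesis
    using B B' P D by (simp add: bmult_bone_left bmult_bone_right)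
qed

lemma model_mat_last_unitriangular:
  "block_unitriangular N (\<lambda>k. if k = N then 0 else Suc k) (model_mat_last N G)"
  by (auto simp: block_unitriangular_def model_mat_last_def bmat_carrier_def split: if_splits)

lemma model_mat_first_unitriangular: "block_unitriangular N (\<lambda>k. k) (model_mat_first N G)"
  by (auto simp: block_unitriangular_def model_mat_first_def bmat_carrier_def split: if_splits)

section \<open>Fourier uniqueness on generated sigma-algebras\<close>

lemma char_uniqueness_real:
  fixes H Y :: "'a \<Rightarrow> real"
  assumes H: "integrable M H" and Y [measurable]: "Y \<in> borel_measurable M"
    and zero: "\<And>t. (CLINT \<omega>|M. iexp (t * Y \<omega>) * complex_of_real (H \<omega>)) = 0"
    and A [measurable]: "A \<in> sets borel"
  shows "(LINT \<omega>|M. indicator A (Y \<omega>) * H \<omega>) = 0"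
proof -
  have [measurable]: "H \<in> borel_measurable M" using H by auto
  define p where "p \<omega> = max 0 (H \<omega>)" for \<omega>
  define q where "q \<omega> = max 0 (- H \<omega>)" for \<omega>
  have [measurable]: "p \<in> borel_measurable M" "q \<in> borel_measurable M"
    by (auto simp: p_def[abs_def] q_def[abs_def])
  have p: "integrable M p" and q: "integrable M q"
    using H by (auto simp: p_def[abs_def] q_def[abs_def])
  have pq: "H \<omega> = p \<omega> - q \<omega>" "0 \<le> p \<omega>" "0 \<le> q \<omega>" for \<omega>
    by (auto simp: p_def q_def)
  define m where "m = (LINT \<omega>|M. p \<omega>)"
  have "(CLINT \<omega>|M. complex_of_real (H \<omega>)) = 0"
    using zero[of 0] by simp
  then have "(LINT \<omega>|M. H \<omega>) = 0" by simp
  then have m': "m = (LINT \<omega>|M. q \<omega>)"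
    using p q by (simp add: m_def pq)
  show ?thesis
  proof (cases "m = 0")
    case True
    have "AE \<omega> in M. p \<omega> = 0"
      using True p pq integral_nonneg_eq_0_iff_AE[OF p] by (simp add: m_def)
    moreover have "AE \<omega> in M. q \<omega> = 0"
      using True m' q pq integral_nonneg_eq_0_iff_AE[OF q] by simp
    ultimately have "AE \<omega> in M. indicator A (Y \<omega>) * H \<omega> = 0"
      by eventually_elim (simp add: pq)
    then have "(LINT \<omega>|M. indicator A (Y \<omega>) * H \<omega>) = (LINT \<omega>|M. 0)"
      by (intro integral_cong_AE) auto
    then show ?thesis by simp
  next
    case False
    then have m: "m > 0"
      using pq by (simp add: m_def order_less_le)
    define \<nu> where "\<nu> h = distr (density M (\<lambda>\<omega>. ennreal (h \<omega> / m))) borel Y" for h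
    have integral_\<nu>: "integral\<^sup>L (\<nu> h) f = (LINT \<omega>|M. (h \<omega> / m) *\<^sub>R f (Y \<omega>))"
      if [measurable]: "h \<in> borel_measurable M" "f \<in> borel_measurable borel" and "\<And>\<omega>. 0 \<le> h \<omega>"
      for h and f :: "real \<Rightarrow> 'b::{banach, second_countable_topology}"
      using that m by (simp add: \<nu>_def integral_distr integral_density)
    have distr: "real_distribution (\<nu> h)"
      if [measurable]: "h \<in> borel_measurable M" and "\<And>\<omega>. 0 \<le> h \<omega>" "integrable M h" "integral\<^sup>L M h = m"
      for h
    proof -
      have "(\<integral>\<^sup>+ \<omega>. ennreal (h \<omega> / m) \<partial>M) = 1"
        using that m by (subst nn_integral_eq_integral) auto
      then have "emeasure (density M (\<lambda>\<omega>. ennreal (h \<omega> / m))) (space M) = 1"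
        by (subst emeasure_density) (auto cong: nn_integral_cong)
      then have "prob_space (density M (\<lambda>\<omega>. ennreal (h \<omega> / m)))"
        by (intro prob_spaceI) simp
      then have "prob_space (\<nu> h)"
        unfolding \<nu>_def by (intro prob_space.prob_space_distr) auto
      then show ?thesis
        by (simp add: real_distribution_def real_distribution_axioms_def \<nu>_def)
    qed
    have "char (\<nu> p) = char (\<nu> q)"
    proof
      fix t
      have i: "integrable M (\<lambda>\<omega>. (h \<omega> / m) *\<^sub>R iexp (t * Y \<omega>))" if "integrable M h" for h
      proof (rule Bochner_Integration.integrable_bound[where f = "\<lambda>\<omega>. h \<omega> / m"])
        show "integrable M (\<lambda>\<omega>. h \<omega> / m)" using that by simp
        show "(\<lambda>\<omega>. (h \<omega> / m) *\<^sub>R iexp (t * Y \<omega>)) \<in> borel_measurable M"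
          using borel_measurable_integrable[OF that] by measurable
      qed auto
      have "char (\<nu> p) t - char (\<nu> q) t =
          (LINT \<omega>|M. (p \<omega> / m) *\<^sub>R iexp (t * Y \<omega>) - (q \<omega> / m) *\<^sub>R iexp (t * Y \<omega>))"
        unfolding char_def using i[OF p] i[OF q] by (simp add: integral_\<nu> pq)
      also have "\<dots> = (LINT \<omega>|M. (1 / m) *\<^sub>R (iexp (t * Y \<omega>) * complex_of_real (H \<omega>)))"
        by (intro Bochner_Integration.integral_cong refl)
           (simp add: pq scaleR_conv_of_real diff_divide_distrib ring_distribs mult.commute)
      also have "\<dots> = 0"
        using zero[of t] by simp
      finally show "char (\<nu> p) t = char (\<nu> q) t" by simp
    qed
    then have "\<nu> p = \<nu> q"
      using p q m' pq by (intro Levy_uniqueness distr) (auto simp: m_def)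
    then have "(LINT y|\<nu> p. indicator A y :: real) = (LINT y|\<nu> q. indicator A y)"
      by simp
    then have eq: "(LINT \<omega>|M. p \<omega> / m * indicator A (Y \<omega>)) = (LINT \<omega>|M. q \<omega> / m * indicator A (Y \<omega>))"
      by (subst (asm) (1 2) integral_\<nu>) (simp_all add: pq)
    have i: "integrable M (\<lambda>\<omega>. h \<omega> / m * indicator A (Y \<omega>))" if "integrable M h" for h
    proof (rule Bochner_Integration.integrable_bound[where f = "\<lambda>\<omega>. h \<omega> / m"])
      show "integrable M (\<lambda>\<omega>. h \<omega> / m)" using that by simp
      show "(\<lambda>\<omega>. h \<omega> / m * indicator A (Y \<omega>)) \<in> borel_measurable M"
        using borel_measurable_integrable[OF that] by measurable
    qed (auto simp: indicator_def)
    have "(LINT \<omega>|M. indicator A (Y \<omega>) * H \<omega>) =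
        (LINT \<omega>|M. m * (p \<omega> / m * indicator A (Y \<omega>) - q \<omega> / m * indicator A (Y \<omega>)))"
      using m by (intro Bochner_Integration.integral_cong refl) (auto simp: pq field_simps)
    also have "\<dots> = 0"
      using eq i[OF p] i[OF q] by simp
    finally show ?thesis .
  qed
qed

lemma norm_iexp [simp]: "cmod (iexp t) = 1"
  by (rule norm_exp_i_times)

lemma integrable_iexp_mult:
  fixes H :: "'a \<Rightarrow> complex"
  assumes H: "integrable M H" and [measurable]: "Y \<in> borel_measurable M"
  shows "integrable M (\<lambda>\<omega>. iexp (Y \<omega>) * H \<omega>)"
proof (rule Bochner_Integration.integrable_bound[OF H])
  show "(\<lambda>\<omega>. iexp (Y \<omega>) * H \<omega>) \<in> borel_measurable M"
    using borel_measurable_integrable[OF H] by measurable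
qed (simp add: norm_mult)

lemma char_uniqueness_complex:
  fixes H :: "'a \<Rightarrow> complex" and Y :: "'a \<Rightarrow> real"
  assumes H: "integrable M H" and Y [measurable]: "Y \<in> borel_measurable M"
    and zero: "\<And>t. (CLINT \<omega>|M. iexp (t * Y \<omega>) * H \<omega>) = 0"
    and A [measurable]: "A \<in> sets borel"
  shows "(CLINT \<omega>|M. indicator A (Y \<omega>) *\<^sub>R H \<omega>) = 0"
proof -
  have i: "integrable M (\<lambda>\<omega>. iexp (t * Y \<omega>) * H \<omega>)" "integrable M (\<lambda>\<omega>. iexp (t * Y \<omega>) * cnj (H \<omega>))" for t
    using H by (intro integrable_iexp_mult; simp)+
  have zero': "(CLINT \<omega>|M. iexp (t * Y \<omega>) * cnj (H \<omega>)) = 0" for t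
  proof -
    have "(CLINT \<omega>|M. iexp (t * Y \<omega>) * cnj (H \<omega>)) = cnj (CLINT \<omega>|M. iexp (- t * Y \<omega>) * H \<omega>)"
      by (simp add: exp_cnj flip: Bochner_Integration.integral_cnj)
    then show ?thesis using zero[of "- t"] by simp
  qed
  have "(LINT \<omega>|M. indicator A (Y \<omega>) * Re (H \<omega>)) = 0"
  proof (rule char_uniqueness_real[OF _ Y _ A])
    fix t
    have "(CLINT \<omega>|M. iexp (t * Y \<omega>) * complex_of_real (Re (H \<omega>))) =
        (CLINT \<omega>|M. (iexp (t * Y \<omega>) * H \<omega> + iexp (t * Y \<omega>) * cnj (H \<omega>)) / 2)"
      by (intro Bochner_Integration.integral_cong refl)
         (simp add: complex_add_cnj flip: distrib_left)
    then show "(CLINT \<omega>|M. iexp (t * Y \<omega>) * complex_of_real (Re (H \<omega>))) = 0"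
      using i zero zero' by simp
  qed (use H in auto)
  moreover have "(LINT \<omega>|M. indicator A (Y \<omega>) * Im (H \<omega>)) = 0"
  proof (rule char_uniqueness_real[OF _ Y _ A])
    fix t
    have Im: "complex_of_real (Im z) = (z - cnj z) / (2 * \<i>)" for z
      by (simp add: complex_eq_iff)
    have "(CLINT \<omega>|M. iexp (t * Y \<omega>) * complex_of_real (Im (H \<omega>))) =
        (CLINT \<omega>|M. (iexp (t * Y \<omega>) * H \<omega> - iexp (t * Y \<omega>) * cnj (H \<omega>)) / (2 * \<i>))"
      by (intro Bochner_Integration.integral_cong refl)
         (simp only: Im right_diff_distrib times_divide_eq_right)
    then show "(CLINT \<omega>|M. iexp (t * Y \<omega>) * complex_of_real (Im (H \<omega>))) = 0"
      using i zero zero' by simp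
  qed (use H in auto)
  moreover have int: "integrable M (\<lambda>\<omega>. indicator A (Y \<omega>) *\<^sub>R H \<omega>)"
  proof (rule Bochner_Integration.integrable_bound[OF H])
    show "(\<lambda>\<omega>. indicator A (Y \<omega>) *\<^sub>R H \<omega>) \<in> borel_measurable M"
      using borel_measurable_integrable[OF H] by measurable
  qed (simp add: indicator_def)
  ultimately show ?thesis
    by (intro complex_eqI) (simp_all flip: integral_Re integral_Im)
qed

lemma char_uniqueness_family:
  fixes H :: "'a \<Rightarrow> complex" and Y :: "'i \<Rightarrow> 'a \<Rightarrow> real"
  assumes "finite F" "integrable M H" and "\<And>a. a \<in> F \<Longrightarrow> Y a \<in> borel_measurable M"
    and "\<And>t. (CLINT \<omega>|M. iexp (\<Sum>a\<in>F. t a * Y a \<omega>) * H \<omega>) = 0"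
    and "\<And>a. A a \<in> sets borel"
  shows "(CLINT \<omega>|M. (\<Prod>a\<in>F. indicator (A a) (Y a \<omega>)) *\<^sub>R H \<omega>) = 0"
  using assms
proof (induction F arbitrary: H rule: finite_induct)
  case (insert b F)
  have [measurable]: "Y b \<in> borel_measurable M" "\<And>a. a \<in> F \<Longrightarrow> Y a \<in> borel_measurable M"
    "\<And>a. A a \<in> sets borel"
    using insert.prems by auto
  have [measurable]: "H \<in> borel_measurable M"
    using insert.prems by auto
  define K where "K \<omega> = indicator (A b) (Y b \<omega>) *\<^sub>R H \<omega>" for \<omega>
  have "(CLINT \<omega>|M. (\<Prod>a\<in>F. indicator (A a) (Y a \<omega>)) *\<^sub>R K \<omega>) = 0"
  proof (rule insert.IH)
    show "integrable M K"
      by (rule Bochner_Integration.integrable_bound[OF insert.prems(1)])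
         (auto simp: K_def[abs_def] indicator_def)
    fix t :: "'i \<Rightarrow> real"
    have "(CLINT \<omega>|M. indicator (A b) (Y b \<omega>) *\<^sub>R (iexp (\<Sum>a\<in>F. t a * Y a \<omega>) * H \<omega>)) = 0"
    proof (rule char_uniqueness_complex)
      show "integrable M (\<lambda>\<omega>. iexp (\<Sum>a\<in>F. t a * Y a \<omega>) * H \<omega>)"
        using insert.prems(1) by (intro integrable_iexp_mult) measurable
      fix s
      have "(CLINT \<omega>|M. iexp (s * Y b \<omega>) * (iexp (\<Sum>a\<in>F. t a * Y a \<omega>) * H \<omega>)) =
          (CLINT \<omega>|M. iexp (\<Sum>a\<in>insert b F. (t(b := s)) a * Y a \<omega>) * H \<omega>)"
      proof (intro Bochner_Integration.integral_cong refl)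
        fix \<omega>
        have "(\<Sum>a\<in>F. (t(b := s)) a * Y a \<omega>) = (\<Sum>a\<in>F. t a * Y a \<omega>)"
          using insert.hyps by (intro sum.cong) auto
        then show "iexp (s * Y b \<omega>) * (iexp (\<Sum>a\<in>F. t a * Y a \<omega>) * H \<omega>) =
            iexp (\<Sum>a\<in>insert b F. (t(b := s)) a * Y a \<omega>) * H \<omega>"
          using insert.hyps by (simp add: distrib_left exp_add)
      qed
      then show "(CLINT \<omega>|M. iexp (s * Y b \<omega>) * (iexp (\<Sum>a\<in>F. t a * Y a \<omega>) * H \<omega>)) = 0"
        using insert.prems by simp
    qed auto
    then show "(CLINT \<omega>|M. iexp (\<Sum>a\<in>F. t a * Y a \<omega>) * K \<omega>) = 0"
      by (simp add: K_def)
  qed (use insert.prems in auto)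
  then show ?case
    using insert.hyps by (simp add: K_def mult.commute)
qed simp

lemma gen_sigma_measurable:
  assumes "i \<in> I"
  shows "x i \<in> borel_measurable (gen_sigma M x I)"
proof -
  have "(\<lambda>\<omega>. \<lambda>i\<in>I. x i \<omega>) \<in> measurable (gen_sigma M x I) (\<Pi>\<^sub>M i\<in>I. borel)"
    unfolding gen_sigma_def by (intro measurable_vimage_algebra1) (auto simp: space_PiM)
  then have "(\<lambda>\<omega>. (\<lambda>i\<in>I. x i \<omega>) i) \<in> borel_measurable (gen_sigma M x I)"
    by (rule measurable_compose) (rule measurable_component_singleton[OF assms])
  then show ?thesis using assms by simp
qed

lemma space_gen_sigma [simp]: "space (gen_sigma M x I) = space M"
  by (simp add: gen_sigma_def)

lemma gen_sigma_least:
  assumes "space F = space M" "\<And>i. i \<in> I \<Longrightarrow> x i \<in> borel_measurable F"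
  shows "sets (gen_sigma M x I) \<subseteq> sets F"
proof -
  have "(\<lambda>\<omega>. \<lambda>i\<in>I. x i \<omega>) \<in> measurable F (\<Pi>\<^sub>M i\<in>I. borel)"
    using assms(2) by (rule measurable_restrict)
  then show ?thesis
    unfolding gen_sigma_def assms(1)[symmetric] measurable_iff_sets by blast
qed

lemma gen_sigma_mono: "I \<subseteq> J \<Longrightarrow> sets (gen_sigma M x I) \<subseteq> sets (gen_sigma M x J)"
  by (intro gen_sigma_least) (auto intro: gen_sigma_measurable)

lemma fourier_uniqueness:
  fixes H :: "'a \<Rightarrow> complex" and x :: "nat \<Rightarrow> 'a \<Rightarrow> real^'d"
  assumes H: "integrable M H" and I: "finite I"
    and x: "\<And>i. i \<in> I \<Longrightarrow> x i \<in> borel_measurable M"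
    and zero: "\<And>a. (CLINT \<omega>|M. iexp (\<Sum>i\<in>I. a i \<bullet> x i \<omega>) * H \<omega>) = 0"
    and S: "S \<in> sets (gen_sigma M x I)"
  shows "(CLINT \<omega>:S|M. H \<omega>) = 0"
proof -
  let ?Y = "\<lambda>(i, b) \<omega>. x i \<omega> \<bullet> b"
  let ?F = "I \<times> (Basis :: (real^'d) set)"
  have [measurable]: "?Y a \<in> borel_measurable M" if "a \<in> ?F" for a
    using x that by auto
  define C where "C A = {\<omega>\<in>space M. \<forall>i\<in>I. \<forall>b\<in>Basis. x i \<omega> \<bullet> b \<in> A (i, b)}" for A
  define E where "E = {C A | A. \<forall>a. A a \<in> sets (borel :: real measure)}"
  have C_Int: "C A \<inter> C B = C (\<lambda>a. A a \<inter> B a)" for A B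
    by (auto simp: C_def)
  have "Int_stable E"
  proof (rule Int_stableI)
    fix S T assume "S \<in> E" "T \<in> E"
    then obtain A B where "S = C A" "T = C B" "\<And>a. A a \<in> sets borel" "\<And>a. B a \<in> sets borel"
      by (auto simp: E_def)
    then show "S \<inter> T \<in> E"
      unfolding E_def by (auto simp: C_Int intro!: exI[of _ "\<lambda>a. A a \<inter> B a"])
  qed
  have E_Pow: "E \<subseteq> Pow (space M)" by (auto simp: E_def C_def)
  have C_sets: "C A \<in> sets M" if [measurable]: "\<And>a. A a \<in> sets borel" for A
    unfolding C_def
  proof (intro sets.sets_Collect_finite_All I finite_Basis)
    fix i and b :: "real^'d" assume i: "i \<in> I"
    have [measurable]: "x i \<in> borel_measurable M" by (rule x[OF i])
    show "{\<omega>\<in>space M. x i \<omega> \<bullet> b \<in> A (i, b)} \<in> sets M" by measurable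
  qed
  have "sets (gen_sigma M x I) \<subseteq> sets (sigma (space M) E)"
  proof (rule gen_sigma_least)
    fix i assume i: "i \<in> I"
    show "x i \<in> borel_measurable (sigma (space M) E)"
    proof (rule borel_measurable_euclidean_space[THEN iffD2], intro ballI)
      fix b :: "real^'d" assume b: "b \<in> Basis"
      show "(\<lambda>\<omega>. x i \<omega> \<bullet> b) \<in> borel_measurable (sigma (space M) E)"
      proof (rule measurableI)
        fix B :: "real set" assume B: "B \<in> sets borel"
        have "(\<lambda>\<omega>. x i \<omega> \<bullet> b) -` B \<inter> space M = C (\<lambda>a. if a = (i, b) then B else UNIV)"
          using i b by (auto simp: C_def)
        also have "\<dots> \<in> E"
          unfolding E_def using B
          by (intro CollectI exI[of _ "\<lambda>a. if a = (i, b) then B else UNIV"]) simp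
        finally show "(\<lambda>\<omega>. x i \<omega> \<bullet> b) -` B \<inter> space (sigma (space M) E) \<in> sets (sigma (space M) E)"
          using E_Pow by (simp add: space_measure_of_conv)
      qed simp
    qed
  qed (use E_Pow in \<open>simp add: space_measure_of_conv\<close>)
  with S E_Pow have "S \<in> sigma_sets (space M) E" by auto
  then have "S \<in> sets M \<and> (CLINT \<omega>:S|M. H \<omega>) = 0"
  proof (induction rule: sigma_sets_induct_disjoint[OF \<open>Int_stable E\<close> E_Pow, consumes 1])
    case (1 S)
    then obtain A where A: "\<And>a. A a \<in> sets borel" and S: "S = C A"
      by (auto simp: E_def)
    have "(CLINT \<omega>|M. (\<Prod>a\<in>?F. indicator (A a) (?Y a \<omega>)) *\<^sub>R H \<omega>) = 0"
    proof (rule char_uniqueness_family[OF _ H])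
      fix t :: "nat \<times> (real^'d) \<Rightarrow> real"
      have "(\<Sum>i\<in>I. (\<Sum>b\<in>Basis. t (i, b) *\<^sub>R b) \<bullet> x i \<omega>) = (\<Sum>a\<in>?F. t a * ?Y a \<omega>)" for \<omega>
      proof -
        have "(\<Sum>a\<in>?F. t a * ?Y a \<omega>) = (\<Sum>i\<in>I. \<Sum>b\<in>Basis. t (i, b) * (x i \<omega> \<bullet> b))"
          unfolding sum.cartesian_product by (intro sum.cong) auto
        then show ?thesis
          by (simp add: inner_sum_left) (simp add: inner_commute)
      qed
      then show "(CLINT \<omega>|M. iexp (\<Sum>a\<in>?F. t a * ?Y a \<omega>) * H \<omega>) = 0"
        using zero[of "\<lambda>i. \<Sum>b\<in>Basis. t (i, b) *\<^sub>R b"] by simp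
    qed (use I A in auto)
    moreover have "(CLINT \<omega>:S|M. H \<omega>) = (CLINT \<omega>|M. (\<Prod>a\<in>?F. indicator (A a) (?Y a \<omega>)) *\<^sub>R H \<omega>)"
      unfolding set_lebesgue_integral_def
    proof (intro Bochner_Integration.integral_cong refl)
      fix \<omega> assume "\<omega> \<in> space M"
      then have "indicator S \<omega> = (\<Prod>a\<in>?F. indicator (A a) (?Y a \<omega>) :: real)"
      proof (cases "\<omega> \<in> S")
        case True
        then have "(\<Prod>a\<in>?F. indicator (A a) (?Y a \<omega>) :: real) = (\<Prod>a\<in>?F. 1)"
          by (intro prod.cong) (auto simp: S C_def)
        then show ?thesis using True by simp
      next
        case False
        with \<open>\<omega> \<in> space M\<close> obtain i b where "i \<in> I" "b \<in> Basis" "x i \<omega> \<bullet> b \<notin> A (i, b)"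
          by (auto simp: S C_def)
        then have "(\<Prod>a\<in>?F. indicator (A a) (?Y a \<omega>) :: real) = 0"
          using I by (intro prod_zero bexI[of _ "(i, b)"]) auto
        then show ?thesis using False by simp
      qed
      then show "indicator S \<omega> *\<^sub>R H \<omega> = (\<Prod>a\<in>?F. indicator (A a) (?Y a \<omega>)) *\<^sub>R H \<omega>"
        by simp
    qed
    ultimately show ?case
      using C_sets A S by simp
  next
    case 2
    then show ?case by (simp add: set_lebesgue_integral_def)
  next
    case (3 S)
    have "(CLINT \<omega>|M. H \<omega>) = 0"
      using zero[of "\<lambda>_. 0"] by simp
    moreover have "(CLINT \<omega>:(space M - S)|M. H \<omega>) = (CLINT \<omega>|M. H \<omega> - indicator S \<omega> *\<^sub>R H \<omega>)"
      unfolding set_lebesgue_integral_def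
      by (intro Bochner_Integration.integral_cong refl) (auto simp: indicator_def)
    moreover have "integrable M (\<lambda>\<omega>. indicator S \<omega> *\<^sub>R H \<omega>)"
      using 3 H by (intro integrable_mult_indicator) auto
    moreover have "space M - S \<in> sets M"
      using 3 by blast
    ultimately show ?case
      using 3 H by (simp add: set_lebesgue_integral_def)
  next
    case (4 A)
    have "(CLINT \<omega>:(\<Union>i. A i)|M. H \<omega>) = (\<Sum>i. (CLINT \<omega>:(A i)|M. H \<omega>))"
      using 4 H by (intro lebesgue_integral_countable_add)
        (auto simp: disjoint_family_on_def set_integrable_def intro!: integrable_mult_indicator)
    then show ?case
      using 4 by auto
  qed
  then show ?thesis by simp
qed

lemma integral_mult_subalgebra_eq_0:
  fixes H Z :: "'a \<Rightarrow> real"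
  assumes M: "finite_measure M" and F: "subalgebra M F"
    and H: "integrable M H" and Z: "Z \<in> borel_measurable F"
    and ZH: "integrable M (\<lambda>\<omega>. Z \<omega> * H \<omega>)"
    and zero: "\<And>S. S \<in> sets F \<Longrightarrow> (LINT \<omega>:S|M. H \<omega>) = 0"
  shows "(LINT \<omega>|M. Z \<omega> * H \<omega>) = 0"
proof -
  interpret finite_measure M by (rule M)
  interpret finite_measure_subalgebra M F
    by unfold_locales (rule F)
  have "AE \<omega> in M. real_cond_exp M F H \<omega> = 0"
    by (rule real_cond_exp_charact) (simp_all add: H zero)
  then have "(LINT \<omega>|M. Z \<omega> * real_cond_exp M F H \<omega>) = (LINT \<omega>|M. 0)"
    using measurable_from_subalg[OF F Z] by (intro integral_cong_AE) auto
  then show ?thesis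
    using real_cond_exp_intg(2)[OF ZH Z] H by simp
qed

lemma integral_mult_subalgebra_eq_0_complex:
  fixes H Z :: "'a \<Rightarrow> complex"
  assumes M: "finite_measure M" and F: "subalgebra M F"
    and H: "integrable M H" and Z: "Z \<in> borel_measurable F"
    and ZH: "integrable M (\<lambda>\<omega>. Z \<omega> * H \<omega>)"
    and zero: "\<And>S. S \<in> sets F \<Longrightarrow> (CLINT \<omega>:S|M. H \<omega>) = 0"
  shows "(CLINT \<omega>|M. Z \<omega> * H \<omega>) = 0"
proof -
  have [measurable]: "Z \<in> borel_measurable M" "H \<in> borel_measurable M"
    using measurable_from_subalg[OF F Z] H by auto
  have H_S: "integrable M (\<lambda>\<omega>. indicator S \<omega> *\<^sub>R H \<omega>)" if "S \<in> sets F" for S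
    using that F H by (intro integrable_mult_indicator) (auto simp: subalgebra_def)
  have part: "integrable M (\<lambda>\<omega>. z \<omega> * h \<omega>) \<and> (LINT \<omega>|M. z \<omega> * h \<omega>) = 0"
    if h: "h = (\<lambda>\<omega>. Re (H \<omega>)) \<or> h = (\<lambda>\<omega>. Im (H \<omega>))"
      and z: "z = (\<lambda>\<omega>. Re (Z \<omega>)) \<or> z = (\<lambda>\<omega>. Im (Z \<omega>))" for z h
  proof
    have "\<bar>z \<omega> * h \<omega>\<bar> \<le> cmod (Z \<omega> * H \<omega>)" for \<omega>
      using h z by (auto simp: abs_mult norm_mult intro!: mult_mono abs_Re_le_cmod abs_Im_le_cmod)
    then show int: "integrable M (\<lambda>\<omega>. z \<omega> * h \<omega>)"
      using h z by (intro Bochner_Integration.integrable_bound[OF ZH]) auto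
    show "(LINT \<omega>|M. z \<omega> * h \<omega>) = 0"
    proof (rule integral_mult_subalgebra_eq_0[OF M F _ _ int])
      fix S assume S: "S \<in> sets F"
      have "(LINT \<omega>:S|M. Re (H \<omega>)) = Re (CLINT \<omega>:S|M. H \<omega>)"
        "(LINT \<omega>:S|M. Im (H \<omega>)) = Im (CLINT \<omega>:S|M. H \<omega>)"
        unfolding set_lebesgue_integral_def using H_S[OF S] by (simp_all flip: integral_Re integral_Im)
      then show "(LINT \<omega>:S|M. h \<omega>) = 0"
        using zero[OF S] h by auto
    qed (use H Z h z in auto)
  qed
  show ?thesis
    using part ZH by (intro complex_eqI) (simp_all flip: integral_Re integral_Im)
qed

section \<open>Covariances of Gaussian sequences\<close>

definition centered_L2 :: "'a measure \<Rightarrow> ('a \<Rightarrow> real^'d) \<Rightarrow> bool" where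
  "centered_L2 M X \<longleftrightarrow> integrable M X \<and> integral\<^sup>L M X = 0 \<and> (\<forall>v. integrable M (\<lambda>\<omega>. (v \<bullet> X \<omega>)\<^sup>2))"

lemma integrable_mult_of_squares:
  fixes f g :: "'a \<Rightarrow> real"
  assumes "integrable M (\<lambda>\<omega>. (f \<omega>)\<^sup>2)" "integrable M (\<lambda>\<omega>. (g \<omega>)\<^sup>2)"
    and "f \<in> borel_measurable M" "g \<in> borel_measurable M"
  shows "integrable M (\<lambda>\<omega>. f \<omega> * g \<omega>)"
proof (rule Bochner_Integration.integrable_bound)
  show "integrable M (\<lambda>\<omega>. (f \<omega>)\<^sup>2 + (g \<omega>)\<^sup>2)" using assms by simp
  have "\<bar>a * b\<bar> \<le> a\<^sup>2 + b\<^sup>2" for a b :: real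
    using sum_squares_bound[of "\<bar>a\<bar>" "\<bar>b\<bar>"] mult_nonneg_nonneg[of "\<bar>a\<bar>" "\<bar>b\<bar>"]
    unfolding abs_mult power2_abs by linarith
  then show "AE \<omega> in M. norm (f \<omega> * g \<omega>) \<le> norm ((f \<omega>)\<^sup>2 + (g \<omega>)\<^sup>2)"
    by simp
qed (use assms in measurable)

lemma centered_L2_measurable: "centered_L2 M X \<Longrightarrow> X \<in> borel_measurable M"
  by (auto simp: centered_L2_def)

lemma centered_L2_integrable_mult:
  assumes "centered_L2 M X" "centered_L2 M Y"
  shows "integrable M (\<lambda>\<omega>. (v \<bullet> X \<omega>) * (w \<bullet> Y \<omega>))"
  using assms centered_L2_measurable[OF assms(1)] centered_L2_measurable[OF assms(2)]
  by (intro integrable_mult_of_squares) (auto simp: centered_L2_def)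

lemma cov_mat_inner:
  assumes X: "centered_L2 M X" and Y: "centered_L2 M Y"
  shows "v \<bullet> (cov_mat M X Y *v w) = (LINT \<omega>|M. (v \<bullet> X \<omega>) * (w \<bullet> Y \<omega>))"
proof -
  have i: "integrable M (\<lambda>\<omega>. X \<omega> $ r * Y \<omega> $ s)" for r s
    using centered_L2_integrable_mult[OF X Y, of "axis r 1" "axis s 1"] by (simp add: inner_axis' )
  have "(LINT \<omega>|M. (v \<bullet> X \<omega>) * (w \<bullet> Y \<omega>)) =
      (LINT \<omega>|M. (\<Sum>r\<in>UNIV. \<Sum>s\<in>UNIV. v $ r * w $ s * (X \<omega> $ r * Y \<omega> $ s)))"
    by (simp add: inner_vec_def sum_product mult_ac)
  also have "\<dots> = (\<Sum>r\<in>UNIV. \<Sum>s\<in>UNIV. v $ r * w $ s * (LINT \<omega>|M. X \<omega> $ r * Y \<omega> $ s))"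
    using i by simp
  also have "\<dots> = v \<bullet> (cov_mat M X Y *v w)"
    using X Y by (simp add: inner_vec_def matrix_vector_mult_def cov_mat_def centered_L2_def
      sum_distrib_left mult_ac)
  finally show ?thesis ..
qed

lemma matrix_eq_inner:
  fixes A B :: "real^'n^'m"
  assumes "\<And>v w. v \<bullet> (A *v w) = v \<bullet> (B *v w)"
  shows "A = B"
  using assms by (metis matrix_eq vector_eq_ldot)

lemma cov_mat_eqI:
  assumes "centered_L2 M X" "centered_L2 M Y"
    and "\<And>v w. (LINT \<omega>|M. (v \<bullet> X \<omega>) * (w \<bullet> Y \<omega>)) = v \<bullet> (C *v w)"
  shows "cov_mat M X Y = C"
  using assms by (intro matrix_eq_inner) (simp add: cov_mat_inner)

lemma centered_L2_matrix:
  assumes X: "centered_L2 M X"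
  shows "centered_L2 M (\<lambda>\<omega>. A *v X \<omega>)"
proof -
  have "v \<bullet> (A *v y) = (v v* A) \<bullet> y" for v y
    by (simp add: dot_lmul_matrix)
  moreover have "integrable M (\<lambda>\<omega>. A *v X \<omega>)" "integral\<^sup>L M (\<lambda>\<omega>. A *v X \<omega>) = A *v integral\<^sup>L M X"
    using X integrable_bounded_linear[OF matrix_vector_mul_bounded_linear, of M X A]
      integral_bounded_linear[OF matrix_vector_mul_bounded_linear, of M X A]
    by (simp_all add: centered_L2_def)
  ultimately show ?thesis
    using X by (simp add: centered_L2_def)
qed

lemma centered_L2_add:
  assumes X: "centered_L2 M X" and Y: "centered_L2 M Y"
  shows "centered_L2 M (\<lambda>\<omega>. X \<omega> + Y \<omega>)"
proof -
  have "(v \<bullet> (X \<omega> + Y \<omega>))\<^sup>2 = (v \<bullet> X \<omega>)\<^sup>2 + (v \<bullet> Y \<omega>)\<^sup>2 + 2 * ((v \<bullet> X \<omega>) * (v \<bullet> Y \<omega>))" for v \<omega>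
    by (simp add: inner_add_right power2_sum)
  then show ?thesis
    using X Y centered_L2_integrable_mult[OF X Y] by (simp add: centered_L2_def)
qed

lemma centered_L2_zero: "centered_L2 M (\<lambda>_. 0)"
  by (simp add: centered_L2_def)

lemma centered_L2_sum:
  "(\<And>k. k \<in> S \<Longrightarrow> centered_L2 M (X k)) \<Longrightarrow> centered_L2 M (\<lambda>\<omega>. \<Sum>k\<in>S. X k \<omega>)"
  by (induction S rule: infinite_finite_induct) (auto intro: centered_L2_zero centered_L2_add)

lemma cov_mat_matrix_left:
  assumes "centered_L2 M X" "centered_L2 M Y"
  shows "cov_mat M (\<lambda>\<omega>. A *v X \<omega>) Y = A ** cov_mat M X Y"
proof (intro cov_mat_eqI centered_L2_matrix assms)
  fix v w
  have "(LINT \<omega>|M. (v \<bullet> (A *v X \<omega>)) * (w \<bullet> Y \<omega>)) = (LINT \<omega>|M. ((v v* A) \<bullet> X \<omega>) * (w \<bullet> Y \<omega>))"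
    by (simp add: dot_lmul_matrix)
  also have "\<dots> = v \<bullet> (A *v (cov_mat M X Y *v w))"
    using cov_mat_inner[OF assms, of "v v* A" w] by (simp only: dot_lmul_matrix)
  finally show "(LINT \<omega>|M. (v \<bullet> (A *v X \<omega>)) * (w \<bullet> Y \<omega>)) = v \<bullet> (A ** cov_mat M X Y *v w)"
    by (simp add: matrix_vector_mul_assoc)
qed

lemma cov_mat_add_left:
  assumes "centered_L2 M X" "centered_L2 M Y" "centered_L2 M W"
  shows "cov_mat M (\<lambda>\<omega>. X \<omega> + Y \<omega>) W = cov_mat M X W + cov_mat M Y W"
  using assms
  by (intro cov_mat_eqI centered_L2_add)
     (simp_all add: cov_mat_inner inner_add_right distrib_right matrix_vector_mult_add_rdistrib
       centered_L2_integrable_mult)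

lemma cov_mat_zero_left: "cov_mat M (\<lambda>_. 0) W = 0"
  by (simp add: cov_mat_def vec_eq_iff)

lemma cov_mat_sum_left:
  assumes "\<And>k. k \<in> S \<Longrightarrow> centered_L2 M (X k)" "centered_L2 M W"
  shows "cov_mat M (\<lambda>\<omega>. \<Sum>k\<in>S. X k \<omega>) W = (\<Sum>k\<in>S. cov_mat M (X k) W)"
  using assms
  by (induction S rule: infinite_finite_induct)
     (auto simp: cov_mat_zero_left cov_mat_add_left centered_L2_sum)

lemma transpose_cov_mat: "transpose (cov_mat M X Y) = cov_mat M Y X"
  by (simp add: cov_mat_def transpose_def mult.commute)

lemma cov_mat_AE_cong:
  assumes "centered_L2 M X" "centered_L2 M X'" "centered_L2 M Y" "AE \<omega> in M. X \<omega> = X' \<omega>"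
  shows "cov_mat M X Y = cov_mat M X' Y"
proof (rule cov_mat_eqI)
  fix v w
  have [measurable]: "X \<in> borel_measurable M" "X' \<in> borel_measurable M" "Y \<in> borel_measurable M"
    using assms by (auto intro: centered_L2_measurable)
  have "(LINT \<omega>|M. (v \<bullet> X \<omega>) * (w \<bullet> Y \<omega>)) = (LINT \<omega>|M. (v \<bullet> X' \<omega>) * (w \<bullet> Y \<omega>))"
    using assms(4) by (intro integral_cong_AE) auto
  then show "(LINT \<omega>|M. (v \<bullet> X \<omega>) * (w \<bullet> Y \<omega>)) = v \<bullet> (cov_mat M X' Y *v w)"
    using assms by (simp add: cov_mat_inner)
qed (use assms in auto)

lemma cov_mat_eq_0_of_variance_0:
  assumes X: "centered_L2 M X" and Y: "centered_L2 M Y"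
    and zero: "v \<bullet> (cov_mat M X X *v v) = 0"
  shows "v v* cov_mat M X Y = 0"
proof -
  have [measurable]: "X \<in> borel_measurable M" "Y \<in> borel_measurable M"
    using X Y by (auto intro: centered_L2_measurable)
  have "(LINT \<omega>|M. (v \<bullet> X \<omega>)\<^sup>2) = 0"
    using zero X by (simp add: cov_mat_inner power2_eq_square)
  then have AE: "AE \<omega> in M. v \<bullet> X \<omega> = 0"
    using X by (subst (asm) integral_nonneg_eq_0_iff_AE) (auto simp: centered_L2_def)
  have "(v v* cov_mat M X Y) \<bullet> w = 0" for w
  proof -
    have "(LINT \<omega>|M. (v \<bullet> X \<omega>) * (w \<bullet> Y \<omega>)) = (LINT \<omega>|M. 0)"
      using AE by (intro integral_cong_AE) auto
    then show ?thesis
      using X Y by (simp add: dot_lmul_matrix cov_mat_inner)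
  qed
  from this[of "v v* cov_mat M X Y"] show ?thesis by simp
qed

lemma (in prob_space) gaussian_rv_integrable:
  assumes "gaussian_rv M Y"
  shows "integrable M Y" "integrable M (\<lambda>\<omega>. (Y \<omega>)\<^sup>2)"
proof -
  have [measurable]: "Y \<in> borel_measurable M"
    using assms by (simp add: gaussian_rv_def)
  have "integrable M Y \<and> integrable M (\<lambda>\<omega>. (Y \<omega>)\<^sup>2)"
  proof -
    obtain \<mu> \<sigma> where "(\<sigma> = 0 \<and> (AE \<omega> in M. Y \<omega> = \<mu>)) \<or>
        (\<sigma> > 0 \<and> distributed M lborel Y (normal_density \<mu> \<sigma>))"
      using assms unfolding gaussian_rv_def by blast
    then show ?thesis
    proof (elim disjE conjE)
      assume AE: "AE \<omega> in M. Y \<omega> = \<mu>"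
      have "integrable M Y \<longleftrightarrow> integrable M (\<lambda>_. \<mu>)"
        using AE by (intro integrable_cong_AE) auto
      moreover have "integrable M (\<lambda>\<omega>. (Y \<omega>)\<^sup>2) \<longleftrightarrow> integrable M (\<lambda>_. \<mu>\<^sup>2)"
        using AE by (intro integrable_cong_AE) auto
      ultimately show ?thesis by simp
    next
      assume \<sigma>: "\<sigma> > 0" and D: "distributed M lborel Y (normal_density \<mu> \<sigma>)"
      have 1: "integrable M Y"
        using distributed_integrable[OF D, of "\<lambda>y. y"] integrable_normal_moment_nz_1[OF \<sigma>] by simp
      have 2: "integrable M (\<lambda>\<omega>. (Y \<omega> - \<mu>)\<^sup>2)"
        using distributed_integrable[OF D, of "\<lambda>y. (y - \<mu>)\<^sup>2"] integrable_normal_moment[OF \<sigma>, of \<mu> 2]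
        by simp
      have "(Y \<omega>)\<^sup>2 = (Y \<omega> - \<mu>)\<^sup>2 + 2 * \<mu> * Y \<omega> - \<mu>\<^sup>2" for \<omega>
        by (simp add: power2_eq_square algebra_simps)
      with 1 2 show ?thesis by simp
    qed
  qed
  then show "integrable M Y" "integrable M (\<lambda>\<omega>. (Y \<omega>)\<^sup>2)" by auto
qed

lemma (in prob_space) gaussian_rv_char:
  assumes "gaussian_rv M Y" and mean: "expectation Y = 0"
  shows "(CLINT \<omega>|M. iexp (Y \<omega>)) = complex_of_real (exp (- (expectation (\<lambda>\<omega>. (Y \<omega>)\<^sup>2)) / 2))"
proof -
  have [measurable]: "Y \<in> borel_measurable M"
    using assms by (simp add: gaussian_rv_def)
  obtain \<mu> \<sigma> where "(\<sigma> = 0 \<and> (AE \<omega> in M. Y \<omega> = \<mu>)) \<or>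
      (\<sigma> > 0 \<and> distributed M lborel Y (normal_density \<mu> \<sigma>))"
    using assms unfolding gaussian_rv_def by blast
  then show ?thesis
  proof (elim disjE conjE)
    assume AE: "AE \<omega> in M. Y \<omega> = \<mu>"
    have "expectation Y = (LINT \<omega>|M. \<mu>)"
      using AE by (intro integral_cong_AE) auto
    then have "\<mu> = 0" using mean by (simp add: prob_space)
    have "(LINT \<omega>|M. (Y \<omega>)\<^sup>2) = (LINT \<omega>|M. 0)"
      using AE \<open>\<mu> = 0\<close> by (intro integral_cong_AE) auto
    moreover have "(CLINT \<omega>|M. iexp (Y \<omega>)) = (CLINT \<omega>|M. 1)"
      using AE \<open>\<mu> = 0\<close> by (intro integral_cong_AE) auto
    ultimately show ?thesis by (simp add: prob_space)
  next
    assume \<sigma>: "\<sigma> > 0" and D: "distributed M lborel Y (normal_density \<mu> \<sigma>)"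
    have \<mu>: "\<mu> = 0"
      using normal_distributed_expectation[OF \<sigma> D] mean by simp
    have var: "expectation (\<lambda>\<omega>. (Y \<omega>)\<^sup>2) = \<sigma>\<^sup>2"
      using normal_distributed_variance[OF \<sigma> D] mean by simp
    have "distributed M lborel (\<lambda>\<omega>. Y \<omega> / \<sigma>) std_normal_density"
      using D normal_standard_normal_convert[OF \<sigma>, of Y 0] \<mu> by simp
    then have distr: "distr M lborel (\<lambda>\<omega>. Y \<omega> / \<sigma>) = std_normal_distribution"
      by (rule distributed_distr_eq_density)
    have "char std_normal_distribution \<sigma> = (CLINT \<omega>|M. iexp (\<sigma> * (Y \<omega> / \<sigma>)))"
      unfolding char_def distr[symmetric] by (subst integral_distr) auto
    then show ?thesis
      using \<sigma> by (simp add: char_std_normal_distribution var)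
  qed
qed

section \<open>Conditional independence and orthogonal residuals\<close>

lemma (in prob_space) real_cond_exp_indicator:
  assumes F: "subalgebra M F" and B: "B \<in> sets M"
  shows "AE \<omega> in M. \<bar>indicator B \<omega> - real_cond_exp M F (indicator B) \<omega>\<bar> \<le> 1"
    and "integrable M (real_cond_exp M F (indicator B))"
    and "\<And>f. f \<in> borel_measurable F \<Longrightarrow> integrable M f \<Longrightarrow>
      integrable M (\<lambda>\<omega>. f \<omega> * real_cond_exp M F (indicator B) \<omega>) \<and>
      (LINT \<omega>|M. f \<omega> * real_cond_exp M F (indicator B) \<omega>) = (LINT \<omega>|M. f \<omega> * indicator B \<omega>)"
proof -
  interpret finite_measure_subalgebra M F
    by unfold_locales (rule F)
  have i: "integrable M (indicator B :: 'a \<Rightarrow> real)"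
    using B by (simp add: emeasure_eq_measure)
  show "integrable M (real_cond_exp M F (indicator B))"
    using i by (rule real_cond_exp_int)
  have "AE \<omega> in M. 0 \<le> real_cond_exp M F (indicator B) \<omega>"
    using i by (intro real_cond_exp_ge_c) auto
  moreover have "AE \<omega> in M. real_cond_exp M F (indicator B) \<omega> \<le> 1"
    using i by (intro real_cond_exp_le_c) (auto simp: indicator_def)
  ultimately show "AE \<omega> in M. \<bar>indicator B \<omega> - real_cond_exp M F (indicator B) \<omega>\<bar> \<le> 1"
    by eventually_elim (auto simp: indicator_def)
  fix f :: "'a \<Rightarrow> real" assume f: "f \<in> borel_measurable F" "integrable M f"
  have "integrable M (\<lambda>\<omega>. f \<omega> * indicator B \<omega>)"
    using integrable_mult_indicator[OF B f(2)] by (simp add: mult.commute)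
  from real_cond_exp_intg[OF this f(1)] B
  show "integrable M (\<lambda>\<omega>. f \<omega> * real_cond_exp M F (indicator B) \<omega>) \<and>
      (LINT \<omega>|M. f \<omega> * real_cond_exp M F (indicator B) \<omega>) = (LINT \<omega>|M. f \<omega> * indicator B \<omega>)"
    by simp
qed

lemma cond_indep_altdef:
  assumes M: "prob_space M" and F: "subalgebra M F" and H: "subalgebra M H" and K: "subalgebra M K"
  shows "cond_indep M F H K \<longleftrightarrow>
    (\<forall>A\<in>sets H. \<forall>B\<in>sets K. \<forall>D\<in>sets F.
      (LINT \<omega>:(A \<inter> D)|M. indicator B \<omega> - real_cond_exp M F (indicator B) \<omega>) = (0 :: real))"
proof -
  interpret prob_space M by (rule M)
  interpret finite_measure_subalgebra M F
    by unfold_locales (rule F)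
  have "(AE \<omega> in M. real_cond_exp M F (indicator (A \<inter> B)) \<omega> =
        real_cond_exp M F (indicator A) \<omega> * real_cond_exp M F (indicator B) \<omega>) \<longleftrightarrow>
      (\<forall>D\<in>sets F. (LINT \<omega>:(A \<inter> D)|M. indicator B \<omega> - real_cond_exp M F (indicator B) \<omega>) = (0 :: real))"
    if A': "A \<in> sets H" and B': "B \<in> sets K" for A B
  proof -
    have [measurable]: "A \<in> sets M" "B \<in> sets M"
      using A' B' H K by (auto simp: subalgebra_def)
    let ?ce = "\<lambda>C. real_cond_exp M F (indicator C)"
    have iAB: "integrable M (indicator (A \<inter> B) :: 'a \<Rightarrow> real)" "integrable M (indicator B :: 'a \<Rightarrow> real)"
      by (simp_all add: emeasure_eq_measure)
    have prod: "integrable M (\<lambda>\<omega>. ?ce A \<omega> * ?ce B \<omega>)"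
      using real_cond_exp_indicator(3)[OF F \<open>B \<in> sets M\<close> borel_measurable_cond_exp]
        real_cond_exp_indicator(2)[OF F \<open>A \<in> sets M\<close>] by simp
    have eq: "(LINT \<omega>:(A \<inter> D)|M. indicator B \<omega> - ?ce B \<omega>) =
        (LINT \<omega>:D|M. indicator (A \<inter> B) \<omega>) - (LINT \<omega>:D|M. ?ce A \<omega> * ?ce B \<omega>)" if D: "D \<in> sets F" for D
    proof -
      have [measurable]: "D \<in> sets M" using D F by (auto simp: subalgebra_def)
      have iD: "integrable M (\<lambda>\<omega>. indicator D \<omega> * ?ce B \<omega>)"
        using integrable_mult_indicator[OF \<open>D \<in> sets M\<close> real_cond_exp_indicator(2)[OF F \<open>B \<in> sets M\<close>]]
        by simp
      have "(\<lambda>\<omega>. indicator D \<omega> * ?ce B \<omega>) \<in> borel_measurable F"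
        using D by measurable
      from real_cond_exp_indicator(3)[OF F \<open>A \<in> sets M\<close> this iD]
      have "(LINT \<omega>|M. indicator D \<omega> * ?ce B \<omega> * ?ce A \<omega>) = (LINT \<omega>|M. indicator D \<omega> * ?ce B \<omega> * indicator A \<omega>)"
        by simp
      then have 1: "(LINT \<omega>:D|M. ?ce A \<omega> * ?ce B \<omega>) = (LINT \<omega>:(A \<inter> D)|M. ?ce B \<omega>)"
        by (simp add: set_lebesgue_integral_def indicator_inter_arith mult_ac)
      have 2: "(LINT \<omega>:D|M. indicator (A \<inter> B) \<omega> :: real) = (LINT \<omega>:(A \<inter> D)|M. indicator B \<omega>)"
        by (simp add: set_lebesgue_integral_def indicator_inter_arith mult_ac)
      have "set_integrable M (A \<inter> D) (indicator B :: 'a \<Rightarrow> real)" "set_integrable M (A \<inter> D) (?ce B)"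
        unfolding set_integrable_def
        by (intro integrable_mult_indicator sets.Int \<open>A \<in> sets M\<close> \<open>D \<in> sets M\<close> iAB(2)
          real_cond_exp_indicator(2)[OF F \<open>B \<in> sets M\<close>])+
      then show ?thesis
        unfolding 1 2 by simp
    qed
    show ?thesis
    proof
      assume AE: "AE \<omega> in M. ?ce (A \<inter> B) \<omega> = ?ce A \<omega> * ?ce B \<omega>"
      show "\<forall>D\<in>sets F. (LINT \<omega>:(A \<inter> D)|M. indicator B \<omega> - ?ce B \<omega>) = (0 :: real)"
      proof
        fix D assume D: "D \<in> sets F"
        have [measurable]: "D \<in> sets M" using D F by (auto simp: subalgebra_def)
        have "(LINT \<omega>:D|M. indicator (A \<inter> B) \<omega> :: real) = (LINT \<omega>:D|M. ?ce (A \<inter> B) \<omega>)"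
          using iAB D by (intro real_cond_exp_intA) auto
        also have "\<dots> = (LINT \<omega>:D|M. ?ce A \<omega> * ?ce B \<omega>)"
          unfolding set_lebesgue_integral_def using AE by (intro integral_cong_AE) auto
        finally show "(LINT \<omega>:(A \<inter> D)|M. indicator B \<omega> - ?ce B \<omega>) = (0 :: real)"
          by (simp add: eq[OF D])
      qed
    next
      assume "\<forall>D\<in>sets F. (LINT \<omega>:(A \<inter> D)|M. indicator B \<omega> - ?ce B \<omega>) = (0 :: real)"
      then show "AE \<omega> in M. ?ce (A \<inter> B) \<omega> = ?ce A \<omega> * ?ce B \<omega>"
        using iAB prod by (intro real_cond_exp_charact) (auto simp: eq)
    qed
  qed
  then show ?thesis
    unfolding cond_indep_def by blast
qed

locale gaussian_seq = prob_space M for M :: "'a measure" +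
  fixes N :: nat and x :: "nat \<Rightarrow> 'a \<Rightarrow> real^'d"
  assumes gaussian: "zero_mean_gaussian_seq M N x"
begin

definition lin :: "(nat \<Rightarrow> real^'d) \<Rightarrow> 'a \<Rightarrow> real" where
  "lin a \<omega> = (\<Sum>k\<le>N. a k \<bullet> x k \<omega>)"

lemma gaussian_lin: "gaussian_rv M (lin a)"
  using gaussian by (simp add: zero_mean_gaussian_seq_def lin_def[abs_def])

lemma lin_single: "k \<le> N \<Longrightarrow> lin (\<lambda>i. if i = k then v else 0) \<omega> = v \<bullet> x k \<omega>"
  by (simp add: lin_def if_distrib[of "\<lambda>u. u \<bullet> _"] cong: if_cong)

lemma lin_restrict: "I \<subseteq> {..N} \<Longrightarrow> lin (\<lambda>i. if i \<in> I then a i else 0) \<omega> = (\<Sum>i\<in>I. a i \<bullet> x i \<omega>)"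
  unfolding lin_def by (intro sum.mono_neutral_cong_right) auto

lemma lin_add: "lin (\<lambda>k. a k + b k) \<omega> = lin a \<omega> + lin b \<omega>"
  by (simp add: lin_def inner_add_left sum.distrib)

lemma lin_scaleR: "lin (\<lambda>k. c *\<^sub>R a k) \<omega> = c * lin a \<omega>"
  by (simp add: lin_def sum_distrib_left)

lemma x_measurable [measurable (raw)]: "k \<le> N \<Longrightarrow> x k \<in> borel_measurable M"
  using gaussian by (simp add: zero_mean_gaussian_seq_def)

lemma x_centered: "k \<le> N \<Longrightarrow> centered_L2 M (x k)"
proof -
  assume k: "k \<le> N"
  have g: "gaussian_rv M (\<lambda>\<omega>. v \<bullet> x k \<omega>)" for v
  proof -
    have "lin (\<lambda>i. if i = k then v else 0) = (\<lambda>\<omega>. v \<bullet> x k \<omega>)"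
      using lin_single[OF k] by auto
    then show ?thesis
      using gaussian_lin by metis
  qed
  have "integrable M (\<lambda>\<omega>. \<Sum>b\<in>Basis. (b \<bullet> x k \<omega>) *\<^sub>R b)"
    using gaussian_rv_integrable(1)[OF g] by auto
  then have "integrable M (x k)"
    by (simp add: inner_commute[of _ "x k _"] euclidean_representation)
  then show ?thesis
    using gaussian k gaussian_rv_integrable(2)[OF g]
    by (simp add: centered_L2_def zero_mean_gaussian_seq_def)
qed

lemma lin_measurable [measurable]: "lin a \<in> borel_measurable M"
  using gaussian_lin by (simp add: gaussian_rv_def)

lemma integrable_lin: "integrable M (lin a)" "integrable M (\<lambda>\<omega>. lin a \<omega> * lin b \<omega>)"
  using gaussian_rv_integrable[OF gaussian_lin]
  by (auto intro: integrable_mult_of_squares)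

lemma expectation_lin: "expectation (lin a) = 0"
proof -
  have "integrable M (x k)" "expectation (x k) = 0" if "k \<le> N" for k
    using x_centered[OF that] by (simp_all add: centered_L2_def)
  then show ?thesis
    by (simp add: lin_def[abs_def])
qed

lemma char_lin: "(CLINT \<omega>|M. iexp (lin a \<omega>)) = complex_of_real (exp (- (expectation (\<lambda>\<omega>. (lin a \<omega>)\<^sup>2)) / 2))"
  by (rule gaussian_rv_char[OF gaussian_lin expectation_lin])

lemma char_lin_orthogonal:
  assumes "expectation (\<lambda>\<omega>. lin a \<omega> * lin b \<omega>) = 0"
  shows "(CLINT \<omega>|M. iexp (lin a \<omega> + lin b \<omega>)) = (CLINT \<omega>|M. iexp (lin a \<omega>)) * (CLINT \<omega>|M. iexp (lin b \<omega>))"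
proof -
  have "(CLINT \<omega>|M. iexp (lin a \<omega> + lin b \<omega>)) =
      complex_of_real (exp (- (expectation (\<lambda>\<omega>. (lin a \<omega> + lin b \<omega>)\<^sup>2)) / 2))"
    using char_lin[of "\<lambda>k. a k + b k"] by (simp only: lin_add)
  also have "expectation (\<lambda>\<omega>. (lin a \<omega> + lin b \<omega>)\<^sup>2) =
      expectation (\<lambda>\<omega>. (lin a \<omega>)\<^sup>2) + expectation (\<lambda>\<omega>. (lin b \<omega>)\<^sup>2)"
  proof -
    have "(lin a \<omega> + lin b \<omega>)\<^sup>2 = lin a \<omega> * lin a \<omega> + 2 * (lin a \<omega> * lin b \<omega>) + lin b \<omega> * lin b \<omega>" for \<omega>
      by (simp add: power2_eq_square algebra_simps)
    then show ?thesis
      using integrable_lin assms by (simp add: power2_eq_square)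
  qed
  finally show ?thesis
    by (simp add: char_lin add_divide_distrib exp_add[symmetric] flip: of_real_mult)
qed

lemma gen_sigma_subalgebra: "I \<subseteq> {..N} \<Longrightarrow> subalgebra M (gen_sigma M x I)"
  unfolding subalgebra_def by (intro conjI gen_sigma_least) (auto intro: x_measurable)

lemma residual_char:
  assumes I: "I \<subseteq> {..N}" and orth: "\<And>i w. i \<in> I \<Longrightarrow> expectation (\<lambda>\<omega>. lin r \<omega> * (w \<bullet> x i \<omega>)) = 0"
    and S: "S \<in> sets (gen_sigma M x I)"
  shows "(CLINT \<omega>:S|M. iexp (lin r \<omega>) - (CLINT \<omega>|M. iexp (lin r \<omega>))) = 0"
proof (rule fourier_uniqueness[OF _ _ _ _ S])
  have int: "integrable M (\<lambda>\<omega>. iexp (lin a \<omega>))" for a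
    using integrable_iexp_mult[of M "\<lambda>_. 1" "lin a"] by simp
  then show "integrable M (\<lambda>\<omega>. iexp (lin r \<omega>) - (CLINT \<omega>|M. iexp (lin r \<omega>)))" by simp
  show "finite I" using I finite_subset by blast
  show "x i \<in> borel_measurable M" if "i \<in> I" for i
    using that I by (auto intro: x_measurable)
  fix c :: "nat \<Rightarrow> real^'d"
  define a where "a = (\<lambda>i. if i \<in> I then c i else 0)"
  have a: "lin a \<omega> = (\<Sum>i\<in>I. c i \<bullet> x i \<omega>)" for \<omega>
    unfolding a_def by (rule lin_restrict[OF I])
  have i: "integrable M (\<lambda>\<omega>. lin r \<omega> * (c i \<bullet> x i \<omega>))" if "i \<in> I" for i
    using integrable_lin(2)[of r "\<lambda>k. if k = i then c i else 0"] that I by (auto simp: lin_single)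
  have "expectation (\<lambda>\<omega>. lin a \<omega> * lin r \<omega>) = (\<Sum>i\<in>I. expectation (\<lambda>\<omega>. lin r \<omega> * (c i \<bullet> x i \<omega>)))"
    using i by (simp add: a sum_distrib_left mult.commute)
  also have "\<dots> = 0"
    using orth by simp
  finally have "(CLINT \<omega>|M. iexp (lin a \<omega> + lin r \<omega>)) = (CLINT \<omega>|M. iexp (lin a \<omega>)) * (CLINT \<omega>|M. iexp (lin r \<omega>))"
    by (rule char_lin_orthogonal)
  moreover have "(CLINT \<omega>|M. iexp (lin a \<omega>) * (iexp (lin r \<omega>) - (CLINT \<omega>|M. iexp (lin r \<omega>)))) =
      (CLINT \<omega>|M. iexp (lin a \<omega> + lin r \<omega>)) - (CLINT \<omega>|M. iexp (lin a \<omega>)) * (CLINT \<omega>|M. iexp (lin r \<omega>))"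
    using int[of a] int[of "\<lambda>k. a k + r k"]
    by (simp add: right_diff_distrib distrib_left exp_add lin_add)
  ultimately show "(CLINT \<omega>|M. iexp (\<Sum>i\<in>I. c i \<bullet> x i \<omega>) * (iexp (lin r \<omega>) - (CLINT \<omega>|M. iexp (lin r \<omega>)))) = 0"
    by (simp add: a)
qed

lemma residual_integral:
  assumes I: "I \<subseteq> {..N}" and orth: "\<And>i w. i \<in> I \<Longrightarrow> expectation (\<lambda>\<omega>. lin r \<omega> * (w \<bullet> x i \<omega>)) = 0"
    and S: "S \<in> sets (gen_sigma M x I)"
  shows "(LINT \<omega>:S|M. lin r \<omega>) = 0"
proof -
  have [measurable]: "S \<in> sets M"
    using S gen_sigma_subalgebra[OF I] by (auto simp: subalgebra_def)
  define h where "h \<omega> = indicator S \<omega> - prob S" for \<omega>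
  have int_h: "integrable M h"
    by (simp add: h_def[abs_def] emeasure_eq_measure)
  let ?F = "vimage_algebra (space M) (lin r) borel"
  have F: "subalgebra M ?F"
    using measurable_iff_sets[of "lin r" M borel] lin_measurable[of r] by (simp add: subalgebra_def)
  have "(LINT \<omega>|M. indicator A (lin r \<omega>) * h \<omega>) = 0" if A: "A \<in> sets borel" for A
  proof (rule char_uniqueness_real[OF int_h lin_measurable _ A])
    fix t
    have orth': "expectation (\<lambda>\<omega>. lin (\<lambda>k. t *\<^sub>R r k) \<omega> * (w \<bullet> x i \<omega>)) = 0" if "i \<in> I" for i w
      using orth[OF that] by (simp add: lin_scaleR mult.assoc)
    have int: "integrable M (\<lambda>\<omega>. iexp (t * lin r \<omega>))"
      using integrable_iexp_mult[of M "\<lambda>_. 1" "\<lambda>\<omega>. t * lin r \<omega>"] by simp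
    have "(CLINT \<omega>:S|M. iexp (t * lin r \<omega>) - (CLINT \<omega>|M. iexp (t * lin r \<omega>))) = 0"
      using residual_char[OF I orth' S] by (simp only: lin_scaleR)
    then have "(CLINT \<omega>|M. indicator S \<omega> *\<^sub>R iexp (t * lin r \<omega>)) = prob S * (CLINT \<omega>|M. iexp (t * lin r \<omega>))"
      using int integrable_mult_indicator[OF \<open>S \<in> sets M\<close> int]
      by (simp add: set_lebesgue_integral_def right_diff_distrib emeasure_eq_measure scaleR_conv_of_real)
    moreover have "(CLINT \<omega>|M. iexp (t * lin r \<omega>) * complex_of_real (h \<omega>)) =
        (CLINT \<omega>|M. indicator S \<omega> *\<^sub>R iexp (t * lin r \<omega>)) - prob S * (CLINT \<omega>|M. iexp (t * lin r \<omega>))"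
      using int integrable_mult_indicator[OF \<open>S \<in> sets M\<close> int]
      by (simp add: h_def left_diff_distrib right_diff_distrib scaleR_conv_of_real mult.commute)
    ultimately show "(CLINT \<omega>|M. iexp (t * lin r \<omega>) * complex_of_real (h \<omega>)) = 0" by simp
  qed
  note zero = this
  have "(LINT \<omega>|M. lin r \<omega> * h \<omega>) = 0"
  proof (rule integral_mult_subalgebra_eq_0[OF finite_measure_axioms F int_h])
    show "lin r \<in> borel_measurable ?F"
      by (rule measurable_vimage_algebra1) simp
    show "integrable M (\<lambda>\<omega>. lin r \<omega> * h \<omega>)"
      using integrable_lin(1)[of r] integrable_mult_indicator[OF \<open>S \<in> sets M\<close> integrable_lin(1)[of r]]
      by (simp add: h_def right_diff_distrib mult.commute)
    fix T assume "T \<in> sets ?F"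
    then obtain A where A: "A \<in> sets borel" and T: "T = lin r -` A \<inter> space M"
      by (auto simp: sets_vimage_algebra2)
    have "(LINT \<omega>:T|M. h \<omega>) = (LINT \<omega>|M. indicator A (lin r \<omega>) * h \<omega>)"
      unfolding set_lebesgue_integral_def
      by (intro Bochner_Integration.integral_cong) (auto simp: T indicator_def)
    then show "(LINT \<omega>:T|M. h \<omega>) = 0"
      using zero[OF A] by simp
  qed
  then have "(LINT \<omega>|M. indicator S \<omega> * lin r \<omega>) = prob S * expectation (lin r)"
    using integrable_lin(1)[of r] integrable_mult_indicator[OF \<open>S \<in> sets M\<close> integrable_lin(1)[of r]]
    by (simp add: h_def right_diff_distrib mult.commute)
  then show ?thesis
    by (simp add: expectation_lin set_lebesgue_integral_def)
qed


lemma cond_indepI: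
  assumes U: "U \<subseteq> {..N}" and V: "V \<subseteq> {..N}" and W: "W \<subseteq> {..N}"
    and decomp: "\<And>a. \<exists>p r. (\<forall>\<omega>. (\<Sum>i\<in>U \<union> V. a i \<bullet> x i \<omega>) = (\<Sum>i\<in>U. p i \<bullet> x i \<omega>) + lin r \<omega>) \<and>
      (\<forall>i\<in>U \<union> W. \<forall>w. expectation (\<lambda>\<omega>. lin r \<omega> * (w \<bullet> x i \<omega>)) = 0)"
  shows "cond_indep M (gen_sigma M x U) (gen_sigma M x V) (gen_sigma M x W)"
proof -
  have UW: "U \<union> W \<subseteq> {..N}" and UV: "U \<union> V \<subseteq> {..N}" using U V W by auto
  note sub = gen_sigma_subalgebra[OF U] gen_sigma_subalgebra[OF V] gen_sigma_subalgebra[OF W]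
    gen_sigma_subalgebra[OF UW]
  have "(LINT \<omega>:S|M. indicator B \<omega> - real_cond_exp M (gen_sigma M x U) (indicator B) \<omega>) = (0 :: real)"
    if B: "B \<in> sets (gen_sigma M x W)" and S: "S \<in> sets (gen_sigma M x (U \<union> V))" for B S
  proof -
    have [measurable]: "B \<in> sets M"
      using B sub(3) by (auto simp: subalgebra_def)
    note ce = real_cond_exp_indicator[OF sub(1) \<open>B \<in> sets M\<close>]
    define k where "k \<omega> = indicator B \<omega> - real_cond_exp M (gen_sigma M x U) (indicator B) \<omega>" for \<omega>
    have iB: "integrable M (indicator B :: 'a \<Rightarrow> real)"
      by (simp add: emeasure_eq_measure)
    have int_k: "integrable M k"
      using ce(2) iB by (simp add: k_def[abs_def])
    have k_meas: "k \<in> borel_measurable (gen_sigma M x (U \<union> W))"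
    proof -
      have "B \<in> sets (gen_sigma M x (U \<union> W))"
        using B gen_sigma_mono[of W "U \<union> W" M x] by auto
      moreover have "real_cond_exp M (gen_sigma M x U) (indicator B) \<in> borel_measurable (gen_sigma M x (U \<union> W))"
        using gen_sigma_mono[of U "U \<union> W" M x]
        by (intro measurable_from_subalg[OF _ borel_measurable_cond_exp]) (auto simp: subalgebra_def)
      ultimately show ?thesis
        unfolding k_def[abs_def] by measurable
    qed
    have "(CLINT \<omega>:S|M. complex_of_real (k \<omega>)) = 0"
    proof (rule fourier_uniqueness[OF _ _ _ _ S])
      show "integrable M (\<lambda>\<omega>. complex_of_real (k \<omega>))"
        using int_k by simp
      show "finite (U \<union> V)" using UV finite_subset by blast
      show "x i \<in> borel_measurable M" if "i \<in> U \<union> V" for i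
        using that UV by (auto intro: x_measurable)
      fix a
      obtain p r where a: "\<And>\<omega>. (\<Sum>i\<in>U \<union> V. a i \<bullet> x i \<omega>) = (\<Sum>i\<in>U. p i \<bullet> x i \<omega>) + lin r \<omega>"
        and r: "\<And>i w. i \<in> U \<union> W \<Longrightarrow> expectation (\<lambda>\<omega>. lin r \<omega> * (w \<bullet> x i \<omega>)) = 0"
        using decomp by blast
      define P where "P \<omega> = (\<Sum>i\<in>U. p i \<bullet> x i \<omega>)" for \<omega>
      have P_meas: "P \<in> borel_measurable (gen_sigma M x J)" if "U \<subseteq> J" for J
        unfolding P_def[abs_def] using that
        by (intro borel_measurable_sum borel_measurable_inner) (auto intro: gen_sigma_measurable)
      have [measurable]: "P \<in> borel_measurable M"
        using measurable_from_subalg[OF sub(1) P_meas] by simp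
      have Pk: "(CLINT \<omega>|M. iexp (P \<omega>) * complex_of_real (k \<omega>)) = 0"
      proof (rule integral_mult_subalgebra_eq_0_complex[OF finite_measure_axioms sub(1)])
        show "(\<lambda>\<omega>. iexp (P \<omega>)) \<in> borel_measurable (gen_sigma M x U)"
          using P_meas[OF order_refl] by measurable
        show "integrable M (\<lambda>\<omega>. iexp (P \<omega>) * complex_of_real (k \<omega>))"
          using int_k by (intro integrable_iexp_mult) auto
        fix D assume D: "D \<in> sets (gen_sigma M x U)"
        have [measurable]: "D \<in> sets M"
          using D sub(1) by (auto simp: subalgebra_def)
        have i: "integrable M (\<lambda>\<omega>. indicator D \<omega> * f \<omega>)" if "integrable M f" for f :: "'a \<Rightarrow> real"
          using integrable_mult_indicator[OF \<open>D \<in> sets M\<close> that] by simp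
        have "(LINT \<omega>|M. indicator D \<omega> * real_cond_exp M (gen_sigma M x U) (indicator B) \<omega>) =
            (LINT \<omega>|M. indicator D \<omega> * indicator B \<omega>)"
          using ce(3)[of "indicator D"] D by (simp add: emeasure_eq_measure)
        then have "(LINT \<omega>:D|M. k \<omega>) = 0"
          using i[OF iB] i[OF ce(2)] by (simp add: k_def set_lebesgue_integral_def right_diff_distrib)
        moreover have "(CLINT \<omega>:D|M. complex_of_real (k \<omega>)) = complex_of_real (LINT \<omega>:D|M. k \<omega>)"
          by (rule set_integral_complex_of_real)
        ultimately show "(CLINT \<omega>:D|M. complex_of_real (k \<omega>)) = 0" by simp
      qed (use int_k in simp)
      let ?\<phi> = "CLINT \<omega>|M. iexp (lin r \<omega>)"
      have int_r: "integrable M (\<lambda>\<omega>. iexp (lin r \<omega>))"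
        using integrable_iexp_mult[of M "\<lambda>_. 1" "lin r"] by simp
      have int_Pk: "integrable M (\<lambda>\<omega>. iexp (P \<omega>) * complex_of_real (k \<omega>))"
        using int_k by (intro integrable_iexp_mult) auto
      have int_rPk: "integrable M (\<lambda>\<omega>. iexp (lin r \<omega>) * (iexp (P \<omega>) * complex_of_real (k \<omega>)))"
        using int_k by (intro integrable_iexp_mult) auto
      have "(CLINT \<omega>|M. (iexp (P \<omega>) * complex_of_real (k \<omega>)) * (iexp (lin r \<omega>) - ?\<phi>)) = 0"
      proof (rule integral_mult_subalgebra_eq_0_complex[OF finite_measure_axioms sub(4)])
        show "(\<lambda>\<omega>. iexp (P \<omega>) * complex_of_real (k \<omega>)) \<in> borel_measurable (gen_sigma M x (U \<union> W))"
          using P_meas[of "U \<union> W"] k_meas by measurable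
        show "integrable M (\<lambda>\<omega>. iexp (P \<omega>) * complex_of_real (k \<omega>) * (iexp (lin r \<omega>) - ?\<phi>))"
          using int_rPk int_Pk by (simp add: right_diff_distrib mult.commute)
        show "(CLINT \<omega>:D|M. iexp (lin r \<omega>) - ?\<phi>) = 0" if "D \<in> sets (gen_sigma M x (U \<union> W))" for D
          using residual_char[OF UW r that] .
      qed (use int_r in simp)
      moreover have "(iexp (P \<omega>) * complex_of_real (k \<omega>)) * (iexp (lin r \<omega>) - ?\<phi>) =
          iexp (lin r \<omega>) * (iexp (P \<omega>) * complex_of_real (k \<omega>)) - ?\<phi> * (iexp (P \<omega>) * complex_of_real (k \<omega>))" for \<omega>
        by (simp add: algebra_simps)
      ultimately have "(CLINT \<omega>|M. iexp (lin r \<omega>) * (iexp (P \<omega>) * complex_of_real (k \<omega>))) = 0"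
        using int_rPk int_Pk Pk by simp
      moreover have "iexp (\<Sum>i\<in>U \<union> V. a i \<bullet> x i \<omega>) * complex_of_real (k \<omega>) =
          iexp (lin r \<omega>) * (iexp (P \<omega>) * complex_of_real (k \<omega>))" for \<omega>
        by (simp only: a P_def[symmetric] of_real_add distrib_left exp_add mult_ac)
      ultimately show "(CLINT \<omega>|M. iexp (\<Sum>i\<in>U \<union> V. a i \<bullet> x i \<omega>) * complex_of_real (k \<omega>)) = 0"
        by (simp only:)
    qed
    moreover have "(CLINT \<omega>:S|M. complex_of_real (k \<omega>)) = complex_of_real (LINT \<omega>:S|M. k \<omega>)"
      by (rule set_integral_complex_of_real)
    ultimately show ?thesis
      by (simp add: k_def)
  qed
  moreover have "A \<inter> D \<in> sets (gen_sigma M x (U \<union> V))"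
    if "A \<in> sets (gen_sigma M x V)" "D \<in> sets (gen_sigma M x U)" for A D
    using that gen_sigma_mono[of U "U \<union> V" M x] gen_sigma_mono[of V "U \<union> V" M x] by blast
  ultimately show ?thesis
    by (subst cond_indep_altdef[OF prob_space_axioms sub(1-3)]) blast
qed

lemma cond_indepD:
  assumes U: "U \<subseteq> {..N}" and V: "V \<subseteq> {..N}" and W: "W \<subseteq> {..N}"
    and indep: "cond_indep M (gen_sigma M x U) (gen_sigma M x V) (gen_sigma M x W)"
    and decomp: "\<And>\<omega>. (\<Sum>i\<in>V. a i \<bullet> x i \<omega>) = (\<Sum>i\<in>U. p i \<bullet> x i \<omega>) + lin r \<omega>"
    and r: "\<And>i w. i \<in> U \<Longrightarrow> expectation (\<lambda>\<omega>. lin r \<omega> * (w \<bullet> x i \<omega>)) = 0"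
    and m: "m \<in> W"
  shows "expectation (\<lambda>\<omega>. lin r \<omega> * (w \<bullet> x m \<omega>)) = 0"
proof -
  note sub = gen_sigma_subalgebra[OF U] gen_sigma_subalgebra[OF V] gen_sigma_subalgebra[OF W]
  define P where "P \<omega> = (\<Sum>i\<in>U. p i \<bullet> x i \<omega>)" for \<omega>
  define v where "v \<omega> = (\<Sum>i\<in>V. a i \<bullet> x i \<omega>)" for \<omega>
  have v: "v \<omega> = P \<omega> + lin r \<omega>" for \<omega>
    by (simp add: v_def P_def decomp)
  have P_meas: "P \<in> borel_measurable (gen_sigma M x U)"
    unfolding P_def[abs_def]
    by (intro borel_measurable_sum borel_measurable_inner) (auto intro: gen_sigma_measurable)
  have v_meas: "v \<in> borel_measurable (gen_sigma M x V)"
    unfolding v_def[abs_def]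
    by (intro borel_measurable_sum borel_measurable_inner) (auto intro: gen_sigma_measurable)
  have int_P: "integrable M P" and int_v: "integrable M v"
    using integrable_lin(1) lin_restrict[OF U, of p] lin_restrict[OF V, of a]
    by (simp_all add: P_def[abs_def] v_def[abs_def] flip: lin_restrict[OF U] lin_restrict[OF V])
  have int_r: "integrable M (lin r)" by (rule integrable_lin)
  have "(LINT \<omega>:B|M. lin r \<omega>) = 0" if B': "B \<in> sets (gen_sigma M x W)" for B
  proof -
    have [measurable]: "B \<in> sets M"
      using B' sub(3) by (auto simp: subalgebra_def)
    note ce = real_cond_exp_indicator[OF sub(1) \<open>B \<in> sets M\<close>]
    let ?ce = "real_cond_exp M (gen_sigma M x U) (indicator B)"
    have iB: "integrable M (indicator B :: 'a \<Rightarrow> real)"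
      by (simp add: emeasure_eq_measure)
    have i: "integrable M (\<lambda>\<omega>. f \<omega> * indicator B \<omega>)" if "integrable M f" for f :: "'a \<Rightarrow> real"
      using integrable_mult_indicator[OF \<open>B \<in> sets M\<close> that] by (simp add: mult.commute)
    have ik: "integrable M (\<lambda>\<omega>. f \<omega> * (indicator B \<omega> - ?ce \<omega>))" if "integrable M f" for f :: "'a \<Rightarrow> real"
    proof (rule Bochner_Integration.integrable_bound[OF that])
      show "(\<lambda>\<omega>. f \<omega> * (indicator B \<omega> - ?ce \<omega>)) \<in> borel_measurable M"
        using that by measurable
      show "AE \<omega> in M. norm (f \<omega> * (indicator B \<omega> - ?ce \<omega>)) \<le> norm (f \<omega>)"
        using ce(1) by eventually_elim (simp add: abs_mult mult_left_le)
    qed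
    have ic: "integrable M (\<lambda>\<omega>. f \<omega> * ?ce \<omega>)" if "integrable M f" for f :: "'a \<Rightarrow> real"
      using Bochner_Integration.integrable_diff[OF i[OF that] ik[OF that]] by (simp add: algebra_simps)
    have "(LINT \<omega>|M. v \<omega> * (indicator B \<omega> - ?ce \<omega>)) = 0"
    proof (rule integral_mult_subalgebra_eq_0[OF finite_measure_axioms sub(2) _ v_meas ik[OF int_v]])
      show "integrable M (\<lambda>\<omega>. indicator B \<omega> - ?ce \<omega>)"
        using iB ce(2) by simp
      fix A assume A: "A \<in> sets (gen_sigma M x V)"
      have "A \<inter> space M = A" "space M \<in> sets (gen_sigma M x U)"
        using A sub(2) sets.sets_into_space[of A "gen_sigma M x V"] sets.top[of "gen_sigma M x U"]
        by (auto simp: subalgebra_def)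
      then show "(LINT \<omega>:A|M. indicator B \<omega> - ?ce \<omega>) = 0"
        using indep[unfolded cond_indep_altdef[OF prob_space_axioms sub(1-3)]] A B' by metis
    qed
    then have 1: "(LINT \<omega>|M. v \<omega> * indicator B \<omega>) = (LINT \<omega>|M. v \<omega> * ?ce \<omega>)"
      using i[OF int_v] ic[OF int_v] by (simp add: right_diff_distrib)
    have 2: "(LINT \<omega>|M. ?ce \<omega> * lin r \<omega>) = 0"
    proof (rule integral_mult_subalgebra_eq_0[OF finite_measure_axioms sub(1) int_r])
      show "integrable M (\<lambda>\<omega>. ?ce \<omega> * lin r \<omega>)"
        using ic[OF int_r] by (simp add: mult.commute)
      show "(LINT \<omega>:S|M. lin r \<omega>) = 0" if "S \<in> sets (gen_sigma M x U)" for S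
        using residual_integral[OF U r that] .
    qed simp
    have 3: "(LINT \<omega>|M. P \<omega> * ?ce \<omega>) = (LINT \<omega>|M. P \<omega> * indicator B \<omega>)"
      using ce(3)[OF P_meas int_P] by simp
    have "(LINT \<omega>|M. lin r \<omega> * indicator B \<omega>) = 0"
      using 1 2 3 i[OF int_P] i[OF int_r] ic[OF int_P] ic[OF int_r]
      by (simp add: v distrib_right mult.commute[of _ "lin r _"])
    then show ?thesis
      by (simp add: set_lebesgue_integral_def mult.commute)
  qed
  moreover have "(\<lambda>\<omega>. w \<bullet> x m \<omega>) \<in> borel_measurable (gen_sigma M x W)"
    using m by (intro borel_measurable_inner) (auto intro: gen_sigma_measurable)
  moreover have "integrable M (\<lambda>\<omega>. w \<bullet> x m \<omega> * lin r \<omega>)"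
    using integrable_lin(2)[of "\<lambda>i. if i = m then w else 0" r] m W by (auto simp: lin_single)
  ultimately have "(LINT \<omega>|M. (w \<bullet> x m \<omega>) * lin r \<omega>) = 0"
    by (intro integral_mult_subalgebra_eq_0[OF finite_measure_axioms sub(3) int_r])
  then show ?thesis
    by (simp add: mult.commute)
qed

end

section \<open>Linear projections and reciprocity\<close>

lemma matrix_minus_vector_mult: "(- A) *v (y :: real^'n) = - (A *v y)"
  by (simp add: matrix_vector_mult_def vec_eq_iff sum_negf)

lemma matrix_mult_minus_left: "(- A) ** (B :: real^'n^'m) = - (A ** B)"
  by (simp add: matrix_matrix_mult_def vec_eq_iff sum_negf)

lemma centered_L2_diff:
  assumes "centered_L2 M X" "centered_L2 M Y"
  shows "centered_L2 M (\<lambda>\<omega>. X \<omega> - Y \<omega>)"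
  using centered_L2_add[OF assms(1) centered_L2_matrix[OF assms(2), of "- mat 1"]]
  by (simp add: matrix_minus_vector_mult)

lemma cov_mat_diff_left:
  assumes "centered_L2 M X" "centered_L2 M Y" "centered_L2 M W"
  shows "cov_mat M (\<lambda>\<omega>. X \<omega> - Y \<omega>) W = cov_mat M X W - cov_mat M Y W"
  using cov_mat_add_left[OF assms(1) centered_L2_matrix[OF assms(2), of "- mat 1"] assms(3)]
    cov_mat_matrix_left[OF assms(2,3), of "- mat 1"]
  by (simp add: matrix_minus_vector_mult matrix_mult_minus_left)

lemma sum_UNIV_Plus: "(\<Sum>c\<in>(UNIV :: ('m::finite + 'n::finite) set). f c) = (\<Sum>a\<in>UNIV. f (Inl a)) + (\<Sum>b\<in>UNIV. f (Inr b))"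
  unfolding UNIV_Plus_UNIV[symmetric] by (subst sum.Plus) simp_all

lemma hcat_mult_vcat: "hcat A B ** vcat C D = A ** C + B ** (D :: real^'n^'q)"
  by (simp add: hcat_def vcat_def matrix_matrix_mult_def vec_eq_iff sum_UNIV_Plus)

lemma mult_hcat: "A ** hcat B C = hcat (A ** B) (A ** (C :: real^'n^'m))"
  by (simp add: hcat_def matrix_matrix_mult_def vec_eq_iff split: sum.split)

lemma hcat_add: "hcat A B + hcat C D = hcat (A + C) (B + D)"
  by (simp add: hcat_def vec_eq_iff split: sum.split)

lemma hcat_eq_iff: "hcat A B = hcat C D \<longleftrightarrow> A = C \<and> B = D"
  by (auto simp: hcat_def vec_eq_iff split: sum.splits)

lemma vcat_mult: "vcat A B ** C = vcat (A ** C) (B ** (C :: real^'n^'m))"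
  by (simp add: vcat_def matrix_matrix_mult_def vec_eq_iff split: sum.split)

lemma vcat_eq_iff: "vcat A B = vcat C D \<longleftrightarrow> A = C \<and> B = D"
  by (auto simp: vcat_def vec_eq_iff split: sum.splits)

lemma hcat_split: "\<exists>A B. X = hcat A B"
proof -
  have "X = hcat (\<chi> r c. X $ r $ Inl c) (\<chi> r c. X $ r $ Inr c)"
    by (simp add: hcat_def vec_eq_iff split: sum.split)
  then show ?thesis by blast
qed

lemma cov_mat_projection:
  assumes X: "centered_L2 M X" and Y: "centered_L2 M Y"
  shows "cov_mat M X Y ** pinv (cov_mat M Y Y) ** cov_mat M Y Y = cov_mat M X Y"
proof -
  let ?C = "cov_mat M X Y" and ?S = "cov_mat M Y Y"
  have "?C *v (u - pinv ?S *v (?S *v u)) = 0" for u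
  proof -
    let ?z = "u - pinv ?S *v (?S *v u)"
    have "?S *v ?z = 0"
      using pinv_symmetric[of ?S]
      by (simp add: transpose_cov_mat matrix_vector_mult_diff_distrib matrix_vector_mul_assoc matrix_mul_assoc)
    then have "?z v* cov_mat M Y X = 0"
      by (intro cov_mat_eq_0_of_variance_0[OF Y X]) simp
    then show ?thesis
      by (simp flip: transpose_cov_mat[of M Y X] add: transpose_matrix_vector)
  qed
  then have "?C *v u = (?C ** pinv ?S ** ?S) *v u" for u
    by (simp add: matrix_vector_mult_diff_distrib matrix_vector_mul_assoc matrix_mul_assoc)
  then show ?thesis
    by (simp add: matrix_eq)
qed

context gaussian_seq
begin

abbreviation P :: "'d bmat" where
  "P i j \<equiv> cov_mat M (x i) (x j)"

definition proj :: "nat \<Rightarrow> nat \<Rightarrow> nat \<Rightarrow> real^'d^'d \<Rightarrow> real^'d^'d \<Rightarrow> bool" where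
  "proj i j l A B \<longleftrightarrow> P i j = A ** P j j + B ** P l j \<and> P i l = A ** P j l + B ** P l l"

definition orth :: "nat \<Rightarrow> nat \<Rightarrow> nat \<Rightarrow> nat \<Rightarrow> bool" where
  "orth i j l m \<longleftrightarrow> (\<exists>A B. proj i j l A B \<and> P i m = A ** P j m + B ** P l m)"

lemma proj_pinv:
  assumes "i \<le> N" "j \<le> N" "l \<le> N"
    and AB: "hcat A B = hcat (P i j) (P i l) ** pinv (vcat (hcat (P j j) (P j l)) (hcat (P l j) (P l l)))"
  shows "proj i j l A B"
proof -
  define Y where "Y \<omega> = (vcat (mat 1) 0 :: real^'d^('d + 'd)) *v x j \<omega> + (vcat 0 (mat 1) :: real^'d^('d + 'd)) *v x l \<omega>" for \<omega>
  have Y: "centered_L2 M Y"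
    unfolding Y_def[abs_def] using assms by (intro centered_L2_add centered_L2_matrix x_centered)
  have Y_Inl: "Y \<omega> $ Inl c = x j \<omega> $ c" and Y_Inr: "Y \<omega> $ Inr c = x l \<omega> $ c" for \<omega> c
    by (simp_all add: Y_def vcat_def matrix_vector_mult_def mat_def if_distrib[of "\<lambda>u. u * _"] cong: if_cong)
  have cov: "cov_mat M X Z $ r $ s = (LINT \<omega>|M. X \<omega> $ r * Z \<omega> $ s)"
    if "centered_L2 M X" "centered_L2 M Z" for X Z :: "'a \<Rightarrow> real^('d + 'd)" and r s
    using that by (simp add: cov_mat_def centered_L2_def)
  \<comment> \<open>\<open>cov_mat\<close> needs two vectors of the same dimension, so \<open>x i\<close> is padded with zeros.\<close>
  define X where "X \<omega> = (vcat (mat 1) 0 :: real^'d^('d + 'd)) *v x i \<omega>" for \<omega>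
  have X: "centered_L2 M X"
    unfolding X_def[abs_def] using assms by (intro centered_L2_matrix x_centered)
  have X_Inl: "X \<omega> $ Inl c = x i \<omega> $ c" and X_Inr: "X \<omega> $ Inr c = 0" for \<omega> c
    by (simp_all add: X_def vcat_def matrix_vector_mult_def mat_def if_distrib[of "\<lambda>u. u * _"] cong: if_cong)
  have P: "P a b $ r $ s = (LINT \<omega>|M. x a \<omega> $ r * x b \<omega> $ s)" if "a \<le> N" "b \<le> N" for a b r s
    using x_centered[OF that(1)] x_centered[OF that(2)] by (simp add: cov_mat_def centered_L2_def)
  have 1: "cov_mat M X Y = vcat (hcat (P i j) (P i l)) 0"
    using assms by (auto simp: vec_eq_iff hcat_def vcat_def cov[OF X Y] P X_Inl X_Inr Y_Inl Y_Inr split: sum.split)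
  have 2: "cov_mat M Y Y = vcat (hcat (P j j) (P j l)) (hcat (P l j) (P l l))"
    using assms by (auto simp: vec_eq_iff hcat_def vcat_def cov[OF Y Y] P Y_Inl Y_Inr split: sum.split)
  have "hcat A B ** vcat (hcat (P j j) (P j l)) (hcat (P l j) (P l l)) = hcat (P i j) (P i l)"
    using cov_mat_projection[OF X Y] by (simp add: AB 1 2 vcat_mult vcat_eq_iff)
  then show ?thesis
    by (simp add: hcat_mult_vcat mult_hcat hcat_add hcat_eq_iff proj_def)
qed

lemma proj_exists:
  assumes "i \<le> N" "j \<le> N" "l \<le> N"
  shows "\<exists>A B. proj i j l A B"
  using hcat_split proj_pinv[OF assms] by metis

lemma orth_iff:
  assumes "i \<le> N" "j \<le> N" "l \<le> N" "m \<le> N" and AB: "proj i j l A B"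
  shows "orth i j l m \<longleftrightarrow> P i m = A ** P j m + B ** P l m"
proof -
  obtain C D where "proj m j l C D" using proj_exists[of m j l] assms by blast
  then have "transpose (P m j) = transpose (C ** P j j + D ** P l j)" "transpose (P m l) = transpose (C ** P j l + D ** P l l)"
    by (simp_all add: proj_def)
  then have m: "P j m = P j j ** transpose C + P j l ** transpose D" "P l m = P l j ** transpose C + P l l ** transpose D"
    by (simp_all only: transpose_add matrix_transpose_mul transpose_cov_mat)
  have "A ** P j m + B ** P l m = P i j ** transpose C + P i l ** transpose D" if "proj i j l A B" for A B
  proof -
    have "A ** P j m + B ** P l m = (A ** P j j + B ** P l j) ** transpose C + (A ** P j l + B ** P l l) ** transpose D"
      by (simp add: m matrix_add_ldistrib matrix_mult_add_left matrix_mul_assoc)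
    then show ?thesis
      using that by (simp add: proj_def)
  qed
  then show ?thesis
    using AB unfolding orth_def by metis
qed

lemma orth_sym:
  assumes "i \<le> N" "j \<le> N" "l \<le> N" "m \<le> N" and "orth i j l m"
  shows "orth m j l i"
proof -
  obtain A B where AB: "proj i j l A B" "P i m = A ** P j m + B ** P l m"
    using assms by (auto simp: orth_def)
  obtain C D where CD: "proj m j l C D" using proj_exists[of m j l] assms by blast
  have "P m i = transpose (P i m)"
    by (simp add: transpose_cov_mat)
  also have "\<dots> = P m j ** transpose A + P m l ** transpose B"
    by (simp only: AB(2) transpose_add matrix_transpose_mul transpose_cov_mat)
  also have "\<dots> = C ** (P j j ** transpose A + P j l ** transpose B) + D ** (P l j ** transpose A + P l l ** transpose B)"
    using CD by (simp add: proj_def matrix_add_ldistrib matrix_mult_add_left matrix_mul_assoc)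
  also have "P j j ** transpose A + P j l ** transpose B = transpose (A ** P j j + B ** P l j)"
    by (simp only: transpose_add matrix_transpose_mul transpose_cov_mat)
  also have "\<dots> = P j i"
    using AB(1) by (simp add: proj_def transpose_cov_mat flip: transpose_cov_mat[of M "x i" "x j"])
  also have "P l j ** transpose A + P l l ** transpose B = transpose (A ** P j l + B ** P l l)"
    by (simp only: transpose_add matrix_transpose_mul transpose_cov_mat)
  also have "\<dots> = P l i"
    using AB(1) by (simp add: proj_def transpose_cov_mat flip: transpose_cov_mat[of M "x i" "x l"])
  finally show ?thesis
    using CD by (auto simp: orth_def)
qed

lemma orth_swap: "orth i j l m \<longleftrightarrow> orth i l j m"
  unfolding orth_def proj_def by (metis add.commute)

lemma cov_condition_iff_orth:
  assumes "i \<le> N" "j \<le> N" "k \<le> N" "l \<le> N"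
  shows "cov_condition P i j k l \<longleftrightarrow> orth k j l i"
proof -
  obtain A B where AB: "hcat (P k j) (P k l) ** pinv (vcat (hcat (P j j) (P j l)) (hcat (P l j) (P l l))) = hcat A B"
    using hcat_split by blast
  have "proj k j l A B"
    using assms AB by (intro proj_pinv) auto
  then show ?thesis
    using assms by (simp add: cov_condition_def AB orth_iff hcat_mult_vcat)
qed

definition is_lin :: "('a \<Rightarrow> real) \<Rightarrow> bool" where
  "is_lin f \<longleftrightarrow> (\<exists>a. \<forall>\<omega>. f \<omega> = lin a \<omega>)"

lemma is_lin_inner: "k \<le> N \<Longrightarrow> is_lin (\<lambda>\<omega>. v \<bullet> x k \<omega>)"
  unfolding is_lin_def by (intro exI[of _ "\<lambda>i. if i = k then v else 0"]) (simp add: lin_single)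

lemma is_lin_add:
  assumes "is_lin f" "is_lin g"
  shows "is_lin (\<lambda>\<omega>. f \<omega> + g \<omega>)"
proof -
  obtain a b where "\<And>\<omega>. f \<omega> = lin a \<omega>" "\<And>\<omega>. g \<omega> = lin b \<omega>"
    using assms by (auto simp: is_lin_def)
  then have "f \<omega> + g \<omega> = lin (\<lambda>k. a k + b k) \<omega>" for \<omega>
    by (simp add: lin_add)
  then show ?thesis
    unfolding is_lin_def by blast
qed

lemma is_lin_diff:
  assumes "is_lin f" "is_lin g"
  shows "is_lin (\<lambda>\<omega>. f \<omega> - g \<omega>)"
proof -
  obtain a b where "\<And>\<omega>. f \<omega> = lin a \<omega>" "\<And>\<omega>. g \<omega> = lin b \<omega>"
    using assms by (auto simp: is_lin_def)
  then have "f \<omega> - g \<omega> = lin (\<lambda>k. a k - b k) \<omega>" for \<omega>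
    by (simp add: lin_def inner_diff_left sum_subtractf)
  then show ?thesis
    unfolding is_lin_def by blast
qed

lemma is_lin_zero: "is_lin (\<lambda>\<omega>. 0)"
  unfolding is_lin_def by (intro exI[of _ "\<lambda>_. 0"]) (simp add: lin_def)

lemma is_lin_sum: "(\<And>k. k \<in> S \<Longrightarrow> is_lin (f k)) \<Longrightarrow> is_lin (\<lambda>\<omega>. \<Sum>k\<in>S. f k \<omega>)"
  by (induction S rule: infinite_finite_induct) (auto intro: is_lin_zero is_lin_add)

lemma is_lin_inner_matrix: "k \<le> N \<Longrightarrow> is_lin (\<lambda>\<omega>. v \<bullet> (A *v x k \<omega>))"
  using is_lin_inner[of k "v v* A"] by (simp add: dot_lmul_matrix)

definition resid :: "nat \<Rightarrow> nat \<Rightarrow> nat \<Rightarrow> real^'d^'d \<Rightarrow> real^'d^'d \<Rightarrow> 'a \<Rightarrow> real^'d" where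
  "resid i j l A B \<omega> = x i \<omega> - A *v x j \<omega> - B *v x l \<omega>"

lemma resid_centered: "i \<le> N \<Longrightarrow> j \<le> N \<Longrightarrow> l \<le> N \<Longrightarrow> centered_L2 M (resid i j l A B)"
  unfolding resid_def[abs_def] by (intro centered_L2_diff centered_L2_matrix x_centered)

lemma cov_mat_resid:
  assumes "i \<le> N" "j \<le> N" "l \<le> N" "m \<le> N"
  shows "cov_mat M (resid i j l A B) (x m) = P i m - A ** P j m - B ** P l m"
  unfolding resid_def[abs_def] using assms
  by (simp add: cov_mat_diff_left cov_mat_matrix_left centered_L2_matrix centered_L2_diff x_centered)

lemma is_lin_resid: "i \<le> N \<Longrightarrow> j \<le> N \<Longrightarrow> l \<le> N \<Longrightarrow> is_lin (\<lambda>\<omega>. v \<bullet> resid i j l A B \<omega>)"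
  unfolding resid_def inner_diff_right by (intro is_lin_diff is_lin_inner is_lin_inner_matrix)

lemma reciprocal_iff_orth:
  "reciprocal M N x \<longleftrightarrow> (\<forall>j l i m. j < i \<and> i < l \<and> l \<le> N \<and> m \<le> N \<and> (m < j \<or> l < m) \<longrightarrow> orth i j l m)"
proof
  assume rec: "reciprocal M N x"
  show "\<forall>j l i m. j < i \<and> i < l \<and> l \<le> N \<and> m \<le> N \<and> (m < j \<or> l < m) \<longrightarrow> orth i j l m"
  proof (intro allI impI; elim conjE)
    fix j l i m assume a: "j < i" "i < l" "l \<le> N" "m \<le> N" "m < j \<or> l < m"
    obtain A B where AB: "proj i j l A B"
      using proj_exists[of i j l] a by auto
    have "v \<bullet> (cov_mat M (resid i j l A B) (x m) *v w) = v \<bullet> (0 *v w)" for v w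
    proof -
      obtain r where r: "\<And>\<omega>. v \<bullet> resid i j l A B \<omega> = lin r \<omega>"
        using is_lin_resid[of i j l v A B] a by (auto simp: is_lin_def)
      have r_cov: "expectation (\<lambda>\<omega>. lin r \<omega> * (w \<bullet> x n \<omega>)) = v \<bullet> (cov_mat M (resid i j l A B) (x n) *v w)"
        if "n \<le> N" for n w
        using that a by (simp add: cov_mat_inner resid_centered x_centered flip: r)
      have "expectation (\<lambda>\<omega>. lin r \<omega> * (w \<bullet> x m \<omega>)) = 0"
      proof (rule cond_indepD[where U = "{j, l}" and V = "{j<..<l}" and W = "{..<j} \<union> {l<..N}"])
        show "cond_indep M (gen_sigma M x {j, l}) (gen_sigma M x {j<..<l}) (gen_sigma M x ({..<j} \<union> {l<..N}))"
          using rec a by (auto simp: reciprocal_def)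
        show "(\<Sum>n\<in>{j<..<l}. (if n = i then v else 0) \<bullet> x n \<omega>) =
            (\<Sum>n\<in>{j, l}. (if n = j then v v* A else v v* B) \<bullet> x n \<omega>) + lin r \<omega>" for \<omega>
          using a by (simp add: if_distrib[of "\<lambda>u. u \<bullet> _"] dot_lmul_matrix resid_def inner_diff_right
            flip: r cong: if_cong)
        show "expectation (\<lambda>\<omega>. lin r \<omega> * (w \<bullet> x n \<omega>)) = 0" if "n \<in> {j, l}" for n w
          using that a AB by (auto simp: r_cov cov_mat_resid proj_def)
      qed (use a in auto)
      then show ?thesis
        using r_cov[OF \<open>m \<le> N\<close>] by simp
    qed
    then have "cov_mat M (resid i j l A B) (x m) = 0"
      by (rule matrix_eq_inner)
    then show "orth i j l m"
      using AB a by (simp add: orth_iff[OF _ _ _ _ AB] cov_mat_resid algebra_simps)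
  qed
next
  assume orth: "\<forall>j l i m. j < i \<and> i < l \<and> l \<le> N \<and> m \<le> N \<and> (m < j \<or> l < m) \<longrightarrow> orth i j l m"
  show "reciprocal M N x"
    unfolding reciprocal_def
  proof (intro allI impI; elim conjE)
    fix j l assume jl: "j < l" "l \<le> N"
    have "\<exists>A B. proj i j l A B" if "i \<in> {j<..<l}" for i
      using proj_exists[of i j l] that jl by auto
    then obtain A B where AB: "\<And>i. i \<in> {j<..<l} \<Longrightarrow> proj i j l (A i) (B i)"
      by metis
    have cov0: "cov_mat M (resid i j l (A i) (B i)) (x m) = 0"
      if "i \<in> {j<..<l}" "m \<in> {j, l} \<union> ({..<j} \<union> {l<..N})" for i m
    proof (cases "m \<in> {j, l}")
      case True
      then show ?thesis
        using AB[OF that(1)] that jl by (auto simp: cov_mat_resid proj_def)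
    next
      case False
      then have "orth i j l m"
        using orth that jl by auto
      then show ?thesis
        using that jl orth_iff[of i j l m, OF _ _ _ _ AB[OF that(1)]] by (auto simp: cov_mat_resid)
    qed
    show "cond_indep M (gen_sigma M x {j, l}) (gen_sigma M x {j<..<l}) (gen_sigma M x ({..<j} \<union> {l<..N}))"
    proof (rule cond_indepI)
      fix a :: "nat \<Rightarrow> real^'d"
      let ?V = "{j<..<l}"
      have "is_lin (\<lambda>\<omega>. \<Sum>i\<in>?V. a i \<bullet> resid i j l (A i) (B i) \<omega>)"
        using jl by (intro is_lin_sum is_lin_resid) auto
      then obtain r where r: "\<And>\<omega>. lin r \<omega> = (\<Sum>i\<in>?V. a i \<bullet> resid i j l (A i) (B i) \<omega>)"
        by (auto simp: is_lin_def)
      define p where "p n = (if n = j then a j + (\<Sum>i\<in>?V. a i v* A i) else a l + (\<Sum>i\<in>?V. a i v* B i))" for n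
      have "(\<Sum>i\<in>{j, l} \<union> ?V. a i \<bullet> x i \<omega>) = (\<Sum>i\<in>{j, l}. p i \<bullet> x i \<omega>) + lin r \<omega>" for \<omega>
      proof -
        have "(\<Sum>i\<in>{j, l} \<union> ?V. a i \<bullet> x i \<omega>) = (\<Sum>i\<in>{j, l}. a i \<bullet> x i \<omega>) + (\<Sum>i\<in>?V. a i \<bullet> x i \<omega>)"
          by (intro sum.union_disjoint) auto
        then show ?thesis
          using jl by (simp add: r p_def resid_def inner_add_left inner_sum_left inner_diff_right
            dot_lmul_matrix sum_subtractf)
      qed
      moreover have "expectation (\<lambda>\<omega>. lin r \<omega> * (w \<bullet> x m \<omega>)) = 0"
        if m: "m \<in> {j, l} \<union> ({..<j} \<union> {l<..N})" for m w
      proof -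
        have mN: "m \<le> N" using m jl by auto
        have "expectation (\<lambda>\<omega>. lin r \<omega> * (w \<bullet> x m \<omega>)) =
            (\<Sum>i\<in>?V. expectation (\<lambda>\<omega>. (a i \<bullet> resid i j l (A i) (B i) \<omega>) * (w \<bullet> x m \<omega>)))"
          unfolding r sum_distrib_right using jl mN
          by (intro Bochner_Integration.integral_sum centered_L2_integrable_mult resid_centered x_centered) auto
        also have "\<dots> = (\<Sum>i\<in>?V. a i \<bullet> (cov_mat M (resid i j l (A i) (B i)) (x m) *v w))"
          using jl mN by (intro sum.cong refl cov_mat_inner[symmetric] resid_centered x_centered) auto
        also have "\<dots> = 0"
          using cov0 m by simp
        finally show ?thesis .
      qed
      ultimately show "\<exists>p r. (\<forall>\<omega>. (\<Sum>i\<in>{j, l} \<union> ?V. a i \<bullet> x i \<omega>) = (\<Sum>i\<in>{j, l}. p i \<bullet> x i \<omega>) + lin r \<omega>) \<and>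
          (\<forall>i\<in>{j, l} \<union> ({..<j} \<union> {l<..N}). \<forall>w. expectation (\<lambda>\<omega>. lin r \<omega> * (w \<bullet> x i \<omega>)) = 0)"
        by blast
    qed (use jl in auto)
  qed
qed

end

section \<open>The two models\<close>

context gaussian_seq
begin

definition cov_bmat :: "'d bmat" where
  "cov_bmat i j = (if i \<le> N \<and> j \<le> N then P i j else 0)"

definition innovations :: "'d bmat \<Rightarrow> (nat \<Rightarrow> 'a \<Rightarrow> real^'d) \<Rightarrow> bool" where
  "innovations A e \<longleftrightarrow> (\<forall>k\<le>N. AE \<omega> in M. e k \<omega> = (\<Sum>j\<le>N. A k j *v x j \<omega>))"

lemma cov_mat_innovation:
  assumes "innovations A e" "k \<le> N" "centered_L2 M (e k)" "centered_L2 M Y"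
  shows "cov_mat M (e k) Y = (\<Sum>j\<le>N. A k j ** cov_mat M (x j) Y)"
proof -
  have "cov_mat M (e k) Y = cov_mat M (\<lambda>\<omega>. \<Sum>j\<le>N. A k j *v x j \<omega>) Y"
    using assms by (intro cov_mat_AE_cong centered_L2_sum centered_L2_matrix x_centered) (auto simp: innovations_def)
  also have "\<dots> = (\<Sum>j\<le>N. cov_mat M (\<lambda>\<omega>. A k j *v x j \<omega>) Y)"
    using assms by (intro cov_mat_sum_left centered_L2_matrix x_centered) auto
  also have "\<dots> = (\<Sum>j\<le>N. A k j ** cov_mat M (x j) Y)"
    using assms by (intro sum.cong refl cov_mat_matrix_left x_centered) auto
  finally show ?thesis .
qed

lemma model_cov_eq:
  assumes A: "block_unitriangular N \<rho> A" and e: "zero_mean_white_gaussian_seq M N e"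
    and inn: "innovations A e"
  shows "model_cov M N A e = cov_bmat"
proof -
  interpret e: gaussian_seq M N e
    using e by unfold_locales (simp add: zero_mean_white_gaussian_seq_def)
  have "bmult N (bmult N A cov_bmat) (btranspose A) i j = bdiag N (\<lambda>k. cov_mat M (e k) (e k)) i j" for i j
  proof (cases "i \<le> N \<and> j \<le> N")
    case True
    have "(\<Sum>b\<le>N. A i b ** cov_bmat b a) = cov_mat M (e i) (x a)" if "a \<le> N" for a
      using True that by (simp add: cov_mat_innovation[OF inn] e.x_centered x_centered cov_bmat_def)
    then have "bmult N (bmult N A cov_bmat) (btranspose A) i j = (\<Sum>a\<le>N. cov_mat M (e i) (x a) ** transpose (A j a))"
      using True by (simp add: bmult_def btranspose_def)
    also have "\<dots> = transpose (\<Sum>a\<le>N. A j a ** cov_mat M (x a) (e i))"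
      by (simp add: transpose_sum matrix_transpose_mul transpose_cov_mat)
    also have "\<dots> = cov_mat M (e i) (e j)"
      using True by (simp add: transpose_cov_mat e.x_centered flip: cov_mat_innovation[OF inn])
    also have "\<dots> = bdiag N (\<lambda>k. cov_mat M (e k) (e k)) i j"
      using True e by (simp add: bdiag_def zero_mean_white_gaussian_seq_def)
    finally show ?thesis .
  qed (auto simp: bmult_def bdiag_def)
  then have "bmult N (bmult N A cov_bmat) (btranspose A) = bdiag N (\<lambda>k. cov_mat M (e k) (e k))"
    by blast
  then show ?thesis
    unfolding model_cov_def by (intro binv_congruence[OF A]) (auto simp: bmat_carrier_def cov_bmat_def)
qed

lemma innovation_uncorrelated:
  assumes A: "block_unitriangular N \<rho> A" and e: "zero_mean_white_gaussian_seq M N e"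
    and inn: "innovations A e" and "k \<le> N" "m \<le> N" "\<rho> m < \<rho> k"
  shows "cov_mat M (e k) (x m) = 0"
proof -
  interpret e: gaussian_seq M N e
    using e by unfold_locales (simp add: zero_mean_white_gaussian_seq_def)
  have "cov_mat M (x m) (e k) = 0"
    using assms(5,6)
  proof (induction "\<rho> m" arbitrary: m rule: less_induct)
    case less
    define V where "V a b = cov_mat M (x a) (e b)" for a b
    have "bmult N A V m k = cov_mat M (e m) (e k)"
      using less.prems \<open>k \<le> N\<close> by (simp add: bmult_def V_def cov_mat_innovation[OF inn] e.x_centered)
    also have "\<dots> = 0"
      using less.prems \<open>k \<le> N\<close> e by (auto simp: zero_mean_white_gaussian_seq_def)
    finally have "V m k + (\<Sum>j | j \<le> N \<and> \<rho> j < \<rho> m. A m j ** V j k) = 0"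
      using bmult_unitriangular[OF A, of m k V] less.prems \<open>k \<le> N\<close> by simp
    moreover have "(\<Sum>j | j \<le> N \<and> \<rho> j < \<rho> m. A m j ** V j k) = 0"
      using less by (intro sum.neutral) (auto simp: V_def times0_right)
    ultimately show ?case by (simp add: V_def)
  qed
  then show ?thesis
    by (metis transpose_cov_mat transpose_zero)
qed

lemma white_innovations:
  assumes A: "block_unitriangular N \<rho> A" and inj: "inj_on \<rho> {..N}"
    and e: "\<And>k \<omega>. k \<le> N \<Longrightarrow> e k \<omega> = (\<Sum>j\<le>N. A k j *v x j \<omega>)"
    and orth: "\<And>k m. k \<le> N \<Longrightarrow> m \<le> N \<Longrightarrow> \<rho> m < \<rho> k \<Longrightarrow> cov_mat M (e k) (x m) = 0"
  shows "zero_mean_white_gaussian_seq M N e"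
proof -
  have inn: "innovations A e"
    by (simp add: innovations_def e)
  have e': "e k = (\<lambda>\<omega>. \<Sum>j\<le>N. A k j *v x j \<omega>)" if "k \<le> N" for k
    using e[OF that] by blast
  have centered: "centered_L2 M (e k)" if "k \<le> N" for k
    unfolding e'[OF that] by (intro centered_L2_sum centered_L2_matrix x_centered) auto
  have "gaussian_rv M (\<lambda>\<omega>. \<Sum>k\<le>N. a k \<bullet> e k \<omega>)" for a :: "nat \<Rightarrow> real^'d"
  proof -
    have "is_lin (\<lambda>\<omega>. \<Sum>k\<le>N. \<Sum>j\<le>N. a k \<bullet> (A k j *v x j \<omega>))"
      by (intro is_lin_sum is_lin_inner_matrix) auto
    moreover have "(\<lambda>\<omega>. \<Sum>k\<le>N. a k \<bullet> e k \<omega>) = (\<lambda>\<omega>. \<Sum>k\<le>N. \<Sum>j\<le>N. a k \<bullet> (A k j *v x j \<omega>))"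
      by (simp add: e inner_sum_right)
    ultimately obtain b where "(\<lambda>\<omega>. \<Sum>k\<le>N. a k \<bullet> e k \<omega>) = lin b"
      unfolding is_lin_def by auto
    then show ?thesis
      using gaussian_lin by simp
  qed
  then have "zero_mean_gaussian_seq M N e"
    using centered centered_L2_measurable[OF centered]
    by (auto simp: zero_mean_gaussian_seq_def centered_L2_def)
  moreover have cov: "cov_mat M (e k) (e m) = 0" if "k \<le> N" "m \<le> N" "\<rho> m < \<rho> k" for k m
  proof -
    have "cov_mat M (e m) (e k) = (\<Sum>j\<le>N. A m j ** cov_mat M (x j) (e k))"
      using that by (intro cov_mat_innovation[OF inn] centered)
    also have "\<dots> = 0"
    proof (rule sum.neutral, rule ballI)
      fix j assume "j \<in> {..N}"
      show "A m j ** cov_mat M (x j) (e k) = 0"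
      proof (cases "A m j = 0")
        case False
        with A \<open>m \<le> N\<close> \<open>j \<in> {..N}\<close> have "\<rho> j \<le> \<rho> m"
          by (cases "j = m") (auto simp: block_unitriangular_def intro: less_imp_le)
        then have "cov_mat M (e k) (x j) = 0"
          using that \<open>j \<in> {..N}\<close> by (intro orth) auto
        then have "cov_mat M (x j) (e k) = 0"
          by (metis transpose_cov_mat transpose_zero)
        then show ?thesis by (simp add: times0_right)
      qed (simp add: times0_left)
    qed
    finally show ?thesis
      by (metis transpose_cov_mat transpose_zero)
  qed
  moreover have "cov_mat M (e k) (e m) = 0" if "k \<le> N" "m \<le> N" "k \<noteq> m" for k m
  proof -
    have "\<rho> m < \<rho> k \<or> \<rho> k < \<rho> m"
      using inj that by (metis atMost_iff inj_on_eq_iff linorder_neqE_nat)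
    then show ?thesis
      using cov that by (metis transpose_cov_mat transpose_zero)
  qed
  ultimately show ?thesis
    by (auto simp: zero_mean_white_gaussian_seq_def)
qed

lemma cov_condition_cov_bmat:
  assumes "i \<le> N" "j \<le> N" "k \<le> N" "l \<le> N"
  shows "cov_condition cov_bmat i j k l \<longleftrightarrow> orth k j l i"
  using cov_condition_iff_orth[OF assms] assms by (simp add: cov_condition_def cov_bmat_def)

lemma model_mat_last_row:
  assumes "k \<le> N"
  shows "(\<Sum>j\<le>N. model_mat_last N G k j *v y j) =
    (if k = N then y N else if k = 0 then y 0 - G 0 N *v y N else y k - G k (k - 1) *v y (k - 1) - G k N *v y N)"
proof -
  have "(\<Sum>j\<le>N. model_mat_last N G k j *v y j) = (\<Sum>j\<in>S. model_mat_last N G k j *v y j)"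
    if "S = (if k = N then {N} else if k = 0 then {0, N} else {k, k - 1, N})" for S
    using assms that by (intro sum.mono_neutral_right) (auto simp: model_mat_last_def split: if_splits)
  from this[OF refl] show ?thesis
    using assms by (auto simp: model_mat_last_def matrix_minus_vector_mult)
qed

lemma model_mat_first_row:
  assumes "k \<le> N"
  shows "(\<Sum>j\<le>N. model_mat_first N G k j *v y j) =
    (if k = 0 then y 0 else y k - G k (k - 1) *v y (k - 1) - G k 0 *v y 0)"
proof -
  have row: "(\<Sum>j\<le>N. model_mat_first N G k j *v y j) = (\<Sum>j\<in>S. model_mat_first N G k j *v y j)"
    if "S = (if k = 0 then {0} else if k = 1 then {1, 0} else {k, k - 1, 0})" for S
    using assms that by (intro sum.mono_neutral_right) (auto simp: model_mat_first_def split: if_splits)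
  show ?thesis
  proof (cases "k = 1")
    case True
    have "(2 *\<^sub>R G 1 0) *v y 0 = G 1 0 *v y 0 + G 1 0 *v y 0"
      by (simp only: scaleR_2 matrix_vector_mult_add_rdistrib)
    moreover have "model_mat_first N G 1 0 = - (2 *\<^sub>R G 1 0)"
      using True assms by (simp add: model_mat_first_def)
    ultimately have "model_mat_first N G 1 0 *v y 0 = - (G 1 0 *v y 0 + G 1 0 *v y 0)"
      by (simp only: matrix_minus_vector_mult)
    moreover have "model_mat_first N G 1 1 *v y 1 = y 1"
      using True assms by (simp add: model_mat_first_def)
    ultimately show ?thesis
      using True row[of "{1, 0}"] by (simp add: algebra_simps)
  next
    case False
    then show ?thesis
      using row[OF refl] assms by (auto simp: model_mat_first_def matrix_minus_vector_mult)
  qed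
qed

lemma obeys_model_last_iff:
  assumes "N > 0"
  shows "obeys_model M N N G e x \<longleftrightarrow> innovations (model_mat_last N G) e"
proof -
  have "(AE \<omega> in M. x k \<omega> = G k (k - 1) *v x (k - 1) \<omega> + G k N *v x N \<omega> + e k \<omega>) \<longleftrightarrow>
      (AE \<omega> in M. e k \<omega> = x k \<omega> - G k (k - 1) *v x (k - 1) \<omega> - G k N *v x N \<omega>)" for k
    by (intro AE_cong) (auto simp: algebra_simps)
  moreover have "(AE \<omega> in M. x 0 \<omega> = G 0 N *v x N \<omega> + e 0 \<omega>) \<longleftrightarrow> (AE \<omega> in M. e 0 \<omega> = x 0 \<omega> - G 0 N *v x N \<omega>)"
    by (intro AE_cong) (auto simp: algebra_simps)
  moreover have "(AE \<omega> in M. x N \<omega> = e N \<omega>) \<longleftrightarrow> (AE \<omega> in M. e N \<omega> = x N \<omega>)"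
    by (intro AE_cong) auto
  moreover have "innovations (model_mat_last N G) e \<longleftrightarrow>
      (\<forall>k\<in>{1..N} - {N}. AE \<omega> in M. e k \<omega> = x k \<omega> - G k (k - 1) *v x (k - 1) \<omega> - G k N *v x N \<omega>) \<and>
      (AE \<omega> in M. e N \<omega> = x N \<omega>) \<and> (AE \<omega> in M. e 0 \<omega> = x 0 \<omega> - G 0 N *v x N \<omega>)"
    unfolding innovations_def
  proof (intro iffI conjI ballI allI impI; (elim conjE)?)
    assume a: "\<forall>k\<le>N. AE \<omega> in M. e k \<omega> = (\<Sum>j\<le>N. model_mat_last N G k j *v x j \<omega>)"
    show "AE \<omega> in M. e k \<omega> = x k \<omega> - G k (k - 1) *v x (k - 1) \<omega> - G k N *v x N \<omega>" if "k \<in> {1..N} - {N}" for k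
      using a[rule_format, of k] that by (simp add: model_mat_last_row)
    show "AE \<omega> in M. e N \<omega> = x N \<omega>"
      using a[rule_format, of N] by (simp add: model_mat_last_row)
    show "AE \<omega> in M. e 0 \<omega> = x 0 \<omega> - G 0 N *v x N \<omega>"
      using a[rule_format, of 0] assms by (simp add: model_mat_last_row)
  next
    fix k assume "k \<le> N"
    assume "\<forall>k\<in>{1..N} - {N}. AE \<omega> in M. e k \<omega> = x k \<omega> - G k (k - 1) *v x (k - 1) \<omega> - G k N *v x N \<omega>"
      and "AE \<omega> in M. e N \<omega> = x N \<omega>" "AE \<omega> in M. e 0 \<omega> = x 0 \<omega> - G 0 N *v x N \<omega>"
    then show "AE \<omega> in M. e k \<omega> = (\<Sum>j\<le>N. model_mat_last N G k j *v x j \<omega>)"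
      using \<open>k \<le> N\<close> assms by (auto simp: model_mat_last_row)
  qed
  ultimately show ?thesis
    unfolding obeys_model_def by simp
qed

lemma obeys_model_first_iff:
  assumes "N > 0"
  shows "obeys_model M N 0 G e x \<longleftrightarrow> innovations (model_mat_first N G) e"
proof -
  have "(AE \<omega> in M. x k \<omega> = G k (k - 1) *v x (k - 1) \<omega> + G k 0 *v x 0 \<omega> + e k \<omega>) \<longleftrightarrow>
      (AE \<omega> in M. e k \<omega> = x k \<omega> - G k (k - 1) *v x (k - 1) \<omega> - G k 0 *v x 0 \<omega>)" for k
    by (intro AE_cong) (auto simp: algebra_simps)
  moreover have "(AE \<omega> in M. x 0 \<omega> = e 0 \<omega>) \<longleftrightarrow> (AE \<omega> in M. e 0 \<omega> = x 0 \<omega>)"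
    by (intro AE_cong) auto
  moreover have "innovations (model_mat_first N G) e \<longleftrightarrow>
      (\<forall>k\<in>{1..N} - {0}. AE \<omega> in M. e k \<omega> = x k \<omega> - G k (k - 1) *v x (k - 1) \<omega> - G k 0 *v x 0 \<omega>) \<and>
      (AE \<omega> in M. e 0 \<omega> = x 0 \<omega>)"
    unfolding innovations_def
  proof (intro iffI conjI ballI allI impI; (elim conjE)?)
    assume a: "\<forall>k\<le>N. AE \<omega> in M. e k \<omega> = (\<Sum>j\<le>N. model_mat_first N G k j *v x j \<omega>)"
    show "AE \<omega> in M. e k \<omega> = x k \<omega> - G k (k - 1) *v x (k - 1) \<omega> - G k 0 *v x 0 \<omega>" if "k \<in> {1..N} - {0}" for k
      using a[rule_format, of k] that by (simp add: model_mat_first_row)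
    show "AE \<omega> in M. e 0 \<omega> = x 0 \<omega>"
      using a[rule_format, of 0] by (simp add: model_mat_first_row)
  next
    fix k assume "k \<le> N"
    assume "\<forall>k\<in>{1..N} - {0}. AE \<omega> in M. e k \<omega> = x k \<omega> - G k (k - 1) *v x (k - 1) \<omega> - G k 0 *v x 0 \<omega>"
      and "AE \<omega> in M. e 0 \<omega> = x 0 \<omega>"
    then show "AE \<omega> in M. e k \<omega> = (\<Sum>j\<le>N. model_mat_first N G k j *v x j \<omega>)"
      using \<open>k \<le> N\<close> by (auto simp: model_mat_first_row)
  qed
  ultimately show ?thesis
    unfolding obeys_model_def using assms by simp
qed

lemma innovation_resid_cov:
  assumes "AE \<omega> in M. e \<omega> = x k \<omega> - A *v x i \<omega> - B *v x c \<omega>" "centered_L2 M e"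
    and "k \<le> N" "i \<le> N" "c \<le> N" "m \<le> N"
  shows "cov_mat M e (x m) = P k m - A ** P i m - B ** P c m"
proof -
  have "cov_mat M e (x m) = cov_mat M (resid k i c A B) (x m)"
    using assms by (intro cov_mat_AE_cong resid_centered x_centered) (auto simp: resid_def)
  then show ?thesis
    using assms by (simp add: cov_mat_resid)
qed

lemma reciprocal_imp_last:
  assumes rec: "reciprocal M N x" and N: "N > 0"
  shows "\<exists>G e. zero_mean_white_gaussian_seq M N e \<and> innovations (model_mat_last N G) e"
proof -
  have "\<exists>A B. proj k (k - 1) N A B" if "k \<le> N" for k
    using that by (intro proj_exists) auto
  then obtain A B where AB: "\<And>k. k \<le> N \<Longrightarrow> proj k (k - 1) N (A k) (B k)"
    by metis
  obtain C D where CD: "proj 0 N N C D"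
    using proj_exists[of 0 N N] by auto
  define G :: "'d bmat" where "G k j = (if k = 0 then C + D else if j = N then B k else A k)" for k j
  define e where "e k \<omega> = (\<Sum>j\<le>N. model_mat_last N G k j *v x j \<omega>)" for k \<omega>
  have centered: "centered_L2 M (e k)" for k
    unfolding e_def[abs_def] by (intro centered_L2_sum centered_L2_matrix x_centered) auto
  have orth: "cov_mat M (e k) (x m) = 0" if k: "k < N" and m: "m < k \<or> m = N" for k m
  proof (cases "k = 0")
    case True
    then have "AE \<omega> in M. e 0 \<omega> = x 0 \<omega> - 0 *v x 0 \<omega> - G 0 N *v x N \<omega>"
      using N by (simp add: e_def model_mat_last_row)
    then have "cov_mat M (e 0) (x N) = P 0 N - 0 ** P 0 N - G 0 N ** P N N"
      by (rule innovation_resid_cov[OF _ centered]) auto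
    then show ?thesis
      using True m CD by (simp add: G_def proj_def matrix_mult_add_left times0_left)
  next
    case False
    then have "AE \<omega> in M. e k \<omega> = x k \<omega> - A k *v x (k - 1) \<omega> - B k *v x N \<omega>"
      using k by (simp add: e_def model_mat_last_row G_def)
    then have *: "cov_mat M (e k) (x m) = P k m - A k ** P (k - 1) m - B k ** P N m"
      by (rule innovation_resid_cov[OF _ centered]) (use k m in auto)
    have "P k m = A k ** P (k - 1) m + B k ** P N m"
    proof (cases "m = k - 1 \<or> m = N")
      case True
      then show ?thesis
        using AB[of k] k by (auto simp: proj_def)
    next
      case False
      then have "orth k (k - 1) N m"
        using rec[unfolded reciprocal_iff_orth, rule_format, of "k - 1" k N m] k m \<open>k \<noteq> 0\<close> by auto
      then show ?thesis
        using orth_iff[of k "k - 1" N m, OF _ _ _ _ AB[of k]] k m by auto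
    qed
    then show ?thesis by (simp add: *)
  qed
  have "zero_mean_white_gaussian_seq M N e"
  proof (rule white_innovations[OF model_mat_last_unitriangular[of N G]])
    show "inj_on (\<lambda>k. if k = N then 0 else Suc k) {..N}"
      by (auto simp: inj_on_def)
    show "cov_mat M (e k) (x m) = 0"
      if "k \<le> N" "m \<le> N" "(if m = N then 0 else Suc m) < (if k = N then 0 else Suc k)" for k m
      using that by (intro orth) (auto split: if_splits)
  qed (simp add: e_def)
  moreover have "innovations (model_mat_last N G) e"
    by (simp add: innovations_def e_def)
  ultimately show ?thesis by blast
qed

lemma reciprocal_imp_first:
  assumes rec: "reciprocal M N x" and N: "N > 0"
  shows "\<exists>G e. zero_mean_white_gaussian_seq M N e \<and> innovations (model_mat_first N G) e"
proof -
  have "\<exists>A B. proj k (k - 1) 0 A B" if "k \<le> N" for k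
    using that by (intro proj_exists) auto
  then obtain A B where AB: "\<And>k. k \<le> N \<Longrightarrow> proj k (k - 1) 0 (A k) (B k)"
    by metis
  define G :: "'d bmat" where
    "G k j = (if k = 1 then (1 / 2) *\<^sub>R (A 1 + B 1) else if j = 0 then B k else A k)" for k j
  define e where "e k \<omega> = (\<Sum>j\<le>N. model_mat_first N G k j *v x j \<omega>)" for k \<omega>
  have centered: "centered_L2 M (e k)" for k
    unfolding e_def[abs_def] by (intro centered_L2_sum centered_L2_matrix x_centered) auto
  have orth: "cov_mat M (e k) (x m) = 0" if k: "k \<le> N" and m: "m < k" for k m
  proof -
    have "e k \<omega> = x k \<omega> - A k *v x (k - 1) \<omega> - B k *v x 0 \<omega>" for \<omega>
    proof (cases "k = 1")
      case True
      have "G 1 0 + G 1 0 = A 1 + B 1"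
        by (simp add: G_def flip: scaleR_add_left)
      then have "G 1 0 *v x 0 \<omega> + G 1 0 *v x 0 \<omega> = A 1 *v x 0 \<omega> + B 1 *v x 0 \<omega>"
        by (simp flip: matrix_vector_mult_add_rdistrib)
      then show ?thesis
        using True k by (simp add: e_def model_mat_first_row algebra_simps)
    next
      case False
      then show ?thesis
        using k m by (simp add: e_def model_mat_first_row G_def)
    qed
    then have *: "cov_mat M (e k) (x m) = P k m - A k ** P (k - 1) m - B k ** P 0 m"
      by (intro innovation_resid_cov[OF _ centered]) (use k m in auto)
    have "P k m = A k ** P (k - 1) m + B k ** P 0 m"
    proof (cases "m = k - 1 \<or> m = 0")
      case True
      then show ?thesis
        using AB[OF k] by (auto simp: proj_def)
    next
      case False
      then have "0 < m" "m < k - 1" "k - 1 < k" using m by auto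
      then have "orth m 0 (k - 1) k"
        using rec[unfolded reciprocal_iff_orth, rule_format, of 0 m "k - 1" k] k by simp
      then have "orth k (k - 1) 0 m"
        using orth_sym[of m 0 "k - 1" k] orth_swap k m by auto
      then show ?thesis
        using orth_iff[of k "k - 1" 0 m, OF _ _ _ _ AB[OF k]] k m by auto
    qed
    then show ?thesis by (simp add: *)
  qed
  have "zero_mean_white_gaussian_seq M N e"
  proof (rule white_innovations[OF model_mat_first_unitriangular[of N G]])
    show "cov_mat M (e k) (x m) = 0" if "k \<le> N" "m \<le> N" "m < k" for k m
      using that by (intro orth)
  qed (simp_all add: e_def)
  moreover have "innovations (model_mat_first N G) e"
    by (simp add: innovations_def e_def)
  ultimately show ?thesis by blast
qed

lemma reciprocal_if_last:
  assumes e: "zero_mean_white_gaussian_seq M N e" and inn: "innovations (model_mat_last N G) e"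
    and cond: "\<And>i j k l. l < i \<Longrightarrow> i < j \<Longrightarrow> j < k \<Longrightarrow> k \<le> N \<Longrightarrow> orth k j l i"
  shows "reciprocal M N x"
  unfolding reciprocal_iff_orth
proof (intro allI impI; elim conjE)
  fix j l i m assume a: "j < i" "i < l" "l \<le> N" "m \<le> N" "m < j \<or> l < m"
  have right: "orth i j l m" if "l < m" "m \<le> N" for m
    using orth_sym[of m l j i] cond[of j i l m] orth_swap a that by auto
  show "orth i j l m"
  proof (cases "l < m")
    case False
    then have m: "m < j" using a by auto
    interpret e: gaussian_seq M N e
      using e by unfold_locales (simp add: zero_mean_white_gaussian_seq_def)
    obtain C D where CD: "proj m j N C D"
      using proj_exists[of m j N] a by auto
    have markov: "P m n = C ** P j n + D ** P N n" if "j \<le> n" "n \<le> N" for n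
      using that
    proof (induction n rule: dec_induct)
      case base
      then show ?case using CD by (simp add: proj_def)
    next
      case (step n)
      show ?case
      proof (cases "Suc n = N")
        case True
        then show ?thesis using CD by (simp add: proj_def)
      next
        case False
        then have n: "Suc n < N" using step.prems by simp
        have "AE \<omega> in M. e (Suc n) \<omega> = x (Suc n) \<omega> - G (Suc n) n *v x n \<omega> - G (Suc n) N *v x N \<omega>"
          using inn n unfolding innovations_def by (auto simp: model_mat_last_row dest!: spec[of _ "Suc n"])
        then have cov: "cov_mat M (e (Suc n)) (x b) = P (Suc n) b - G (Suc n) n ** P n b - G (Suc n) N ** P N b"
          if "b \<le> N" for b
          using n that by (intro innovation_resid_cov e.x_centered) auto
        have cov0: "cov_mat M (e (Suc n)) (x b) = 0" if "b = m \<or> b = j \<or> b = N" for b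
          using innovation_uncorrelated[OF model_mat_last_unitriangular e inn, of "Suc n" b] n that m step.hyps a
          by auto
        have *: "P (Suc n) b = G (Suc n) n ** P n b + G (Suc n) N ** P N b"
          if "b = m \<or> b = j \<or> b = N" for b
        proof -
          have "b \<le> N" using that a by auto
          then have "P (Suc n) b - G (Suc n) n ** P n b - G (Suc n) N ** P N b = 0"
            using cov[of b] cov0[of b] that by simp
          then show ?thesis by (simp add: diff_diff_eq)
        qed
        have **: "P b (Suc n) = P b n ** transpose (G (Suc n) n) + P b N ** transpose (G (Suc n) N)"
          if "b = m \<or> b = j \<or> b = N" for b
        proof -
          have "P b (Suc n) = transpose (P (Suc n) b)"
            by (simp add: transpose_cov_mat)
          then show ?thesis
            by (simp only: *[OF that] transpose_add matrix_transpose_mul transpose_cov_mat)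
        qed
        have "P m n = C ** P j n + D ** P N n" "P m N = C ** P j N + D ** P N N"
          using step n CD by (simp_all add: proj_def)
        then show ?thesis
          by (simp add: ** matrix_mult_add_left matrix_add_ldistrib matrix_mul_assoc)
      qed
    qed
    have markov': "P n m = P n j ** transpose C + P n N ** transpose D" if "j \<le> n" "n \<le> N" for n
    proof -
      have "P n m = transpose (P m n)"
        by (simp add: transpose_cov_mat)
      then show ?thesis
        by (simp only: markov[OF that] transpose_add matrix_transpose_mul transpose_cov_mat)
    qed
    obtain A B where AB: "proj i j l A B"
      using proj_exists[of i j l] a by auto
    have "P i N = A ** P j N + B ** P l N"
      using AB right[of N] orth_iff[of i j l N, OF _ _ _ _ AB] a by (cases "l = N") (auto simp: proj_def)
    then have "P i m = A ** P j m + B ** P l m"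
      using a AB by (simp add: markov' proj_def matrix_mult_add_left matrix_add_ldistrib matrix_mul_assoc)
    then show ?thesis
      using AB by (auto simp: orth_def)
  qed (use right a in auto)
qed

lemma reciprocal_if_first:
  assumes e: "zero_mean_white_gaussian_seq M N e" and inn: "innovations (model_mat_first N G) e"
    and cond: "\<And>i j k l. i < j \<Longrightarrow> j < k \<Longrightarrow> k < l \<Longrightarrow> l \<le> N \<Longrightarrow> orth k j l i"
  shows "reciprocal M N x"
  unfolding reciprocal_iff_orth
proof (intro allI impI; elim conjE)
  fix j l i m assume a: "j < i" "i < l" "l \<le> N" "m \<le> N" "m < j \<or> l < m"
  show "orth i j l m"
  proof (cases "m < j")
    case False
    then have m: "l < m" using a by auto
    interpret e: gaussian_seq M N e
      using e by unfold_locales (simp add: zero_mean_white_gaussian_seq_def)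
    have "\<exists>C D. \<forall>b\<le>l. P m b = C ** P l b + D ** P 0 b"
      using less_imp_le[OF m] \<open>m \<le> N\<close>
    proof (induction m rule: dec_induct)
      case base
      show ?case
        by (intro exI[of _ "mat 1"] exI[of _ 0]) (simp add: times0_left)
    next
      case (step n)
      then obtain C D where CD: "\<And>b. b \<le> l \<Longrightarrow> P n b = C ** P l b + D ** P 0 b"
        by auto
      have n: "Suc n \<le> N" "0 < n" using step a by auto
      have "AE \<omega> in M. e (Suc n) \<omega> = x (Suc n) \<omega> - G (Suc n) n *v x n \<omega> - G (Suc n) 0 *v x 0 \<omega>"
        using inn n unfolding innovations_def by (auto simp: model_mat_first_row dest!: spec[of _ "Suc n"])
      then have cov: "cov_mat M (e (Suc n)) (x b) = P (Suc n) b - G (Suc n) n ** P n b - G (Suc n) 0 ** P 0 b"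
        if "b \<le> N" for b
        using n that by (intro innovation_resid_cov e.x_centered) auto
      have cov0: "cov_mat M (e (Suc n)) (x b) = 0" if "b \<le> l" for b
        using innovation_uncorrelated[OF model_mat_first_unitriangular e inn, of "Suc n" b] n that step.hyps
        by auto
      have "P (Suc n) b = G (Suc n) n ** P n b + G (Suc n) 0 ** P 0 b" if "b \<le> l" for b
        using cov[of b] cov0[OF that] that a by (simp add: diff_diff_eq)
      then have "\<forall>b\<le>l. P (Suc n) b = (G (Suc n) n ** C) ** P l b + (G (Suc n) n ** D + G (Suc n) 0) ** P 0 b"
        by (simp add: CD matrix_mult_add_left matrix_add_ldistrib matrix_mul_assoc)
      then show ?case by blast
    qed
    then obtain C D where markov: "\<And>b. b \<le> l \<Longrightarrow> P m b = C ** P l b + D ** P 0 b"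
      by blast
    have markov': "P b m = P b l ** transpose C + P b 0 ** transpose D" if "b \<le> l" for b
    proof -
      have "P b m = transpose (P m b)"
        by (simp add: transpose_cov_mat)
      then show ?thesis
        by (simp only: markov[OF that] transpose_add matrix_transpose_mul transpose_cov_mat)
    qed
    obtain A B where AB: "proj i j l A B"
      using proj_exists[of i j l] a by auto
    have "P i 0 = A ** P j 0 + B ** P l 0"
      using AB cond[of 0 j i l] orth_iff[of i j l 0, OF _ _ _ _ AB] a by (cases "j = 0") (auto simp: proj_def)
    then have "P i m = A ** P j m + B ** P l m"
      using a AB by (simp add: markov' proj_def matrix_mult_add_left matrix_add_ldistrib matrix_mul_assoc)
    then show ?thesis
      using AB by (auto simp: orth_def)
  qed (use cond a in auto)
qed

lemma reciprocal_trivial: "N = 0 \<Longrightarrow> reciprocal M N x"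
  by (simp add: reciprocal_def)

lemma obeys_model_trivial:
  assumes "N = 0"
  shows "zero_mean_white_gaussian_seq M N x \<and> obeys_model M N 0 (\<lambda>_ _. 0) x x"
  using gaussian assms by (simp add: zero_mean_white_gaussian_seq_def obeys_model_def)

theorem reciprocal_iff_last:
  "reciprocal M N x \<longleftrightarrow>
    (\<exists>G e. zero_mean_white_gaussian_seq M N e \<and> obeys_model M N N G e x \<and>
      (\<forall>i\<in>{0..N}. \<forall>j\<in>{0..N}. \<forall>k\<in>{0..N}. \<forall>l\<in>{0..N}. l < i \<and> i < j \<and> j < k \<longrightarrow>
        cov_condition (model_cov M N (model_mat_last N G) e) i j k l))"
proof (cases "N = 0")
  case True
  then show ?thesis
    using reciprocal_trivial obeys_model_trivial by auto
next
  case False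
  then have N: "N > 0" by simp
  show ?thesis
  proof
    assume rec: "reciprocal M N x"
    then obtain G e where e: "zero_mean_white_gaussian_seq M N e" and inn: "innovations (model_mat_last N G) e"
      using reciprocal_imp_last N by blast
    have "orth k j l i" if "l < i" "i < j" "j < k" "k \<le> N" for i j k l
    proof -
      have "orth i l j k"
        using rec[unfolded reciprocal_iff_orth, rule_format, of l i j k] that by auto
      then show ?thesis
        using orth_sym[of i l j k] orth_swap that by auto
    qed
    then show "\<exists>G e. zero_mean_white_gaussian_seq M N e \<and> obeys_model M N N G e x \<and>
      (\<forall>i\<in>{0..N}. \<forall>j\<in>{0..N}. \<forall>k\<in>{0..N}. \<forall>l\<in>{0..N}. l < i \<and> i < j \<and> j < k \<longrightarrow>
        cov_condition (model_cov M N (model_mat_last N G) e) i j k l)"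
      using e inn
      by (intro exI[of _ G] exI[of _ e])
         (auto simp: obeys_model_last_iff[OF N] model_cov_eq[OF model_mat_last_unitriangular] cov_condition_cov_bmat)
  next
    assume "\<exists>G e. zero_mean_white_gaussian_seq M N e \<and> obeys_model M N N G e x \<and>
      (\<forall>i\<in>{0..N}. \<forall>j\<in>{0..N}. \<forall>k\<in>{0..N}. \<forall>l\<in>{0..N}. l < i \<and> i < j \<and> j < k \<longrightarrow>
        cov_condition (model_cov M N (model_mat_last N G) e) i j k l)"
    then obtain G e where e: "zero_mean_white_gaussian_seq M N e" and inn: "innovations (model_mat_last N G) e"
      and cond: "\<forall>i\<in>{0..N}. \<forall>j\<in>{0..N}. \<forall>k\<in>{0..N}. \<forall>l\<in>{0..N}. l < i \<and> i < j \<and> j < k \<longrightarrow>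
        cov_condition (model_cov M N (model_mat_last N G) e) i j k l"
      by (auto simp: obeys_model_last_iff[OF N])
    have "orth k j l i" if "l < i" "i < j" "j < k" "k \<le> N" for i j k l
      using cond[rule_format, of i j k l] that
      by (simp add: model_cov_eq[OF model_mat_last_unitriangular e inn] cov_condition_cov_bmat)
    then show "reciprocal M N x"
      by (rule reciprocal_if_last[OF e inn])
  qed
qed

theorem reciprocal_iff_first:
  "reciprocal M N x \<longleftrightarrow>
    (\<exists>G e. zero_mean_white_gaussian_seq M N e \<and> obeys_model M N 0 G e x \<and>
      (\<forall>i\<in>{0..N}. \<forall>j\<in>{0..N}. \<forall>k\<in>{0..N}. \<forall>l\<in>{0..N}. i < j \<and> j < k \<and> k < l \<longrightarrow>
        cov_condition (model_cov M N (model_mat_first N G) e) i j k l))"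
proof (cases "N = 0")
  case True
  then show ?thesis
    using reciprocal_trivial obeys_model_trivial by auto
next
  case False
  then have N: "N > 0" by simp
  show ?thesis
  proof
    assume rec: "reciprocal M N x"
    then obtain G e where e: "zero_mean_white_gaussian_seq M N e" and inn: "innovations (model_mat_first N G) e"
      using reciprocal_imp_first N by blast
    have "orth k j l i" if "i < j" "j < k" "k < l" "l \<le> N" for i j k l
      using rec[unfolded reciprocal_iff_orth, rule_format, of j k l i] that by auto
    then show "\<exists>G e. zero_mean_white_gaussian_seq M N e \<and> obeys_model M N 0 G e x \<and>
      (\<forall>i\<in>{0..N}. \<forall>j\<in>{0..N}. \<forall>k\<in>{0..N}. \<forall>l\<in>{0..N}. i < j \<and> j < k \<and> k < l \<longrightarrow>
        cov_condition (model_cov M N (model_mat_first N G) e) i j k l)"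
      using e inn
      by (intro exI[of _ G] exI[of _ e])
         (auto simp: obeys_model_first_iff[OF N] model_cov_eq[OF model_mat_first_unitriangular] cov_condition_cov_bmat)
  next
    assume "\<exists>G e. zero_mean_white_gaussian_seq M N e \<and> obeys_model M N 0 G e x \<and>
      (\<forall>i\<in>{0..N}. \<forall>j\<in>{0..N}. \<forall>k\<in>{0..N}. \<forall>l\<in>{0..N}. i < j \<and> j < k \<and> k < l \<longrightarrow>
        cov_condition (model_cov M N (model_mat_first N G) e) i j k l)"
    then obtain G e where e: "zero_mean_white_gaussian_seq M N e" and inn: "innovations (model_mat_first N G) e"
      and cond: "\<forall>i\<in>{0..N}. \<forall>j\<in>{0..N}. \<forall>k\<in>{0..N}. \<forall>l\<in>{0..N}. i < j \<and> j < k \<and> k < l \<longrightarrow>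
        cov_condition (model_cov M N (model_mat_first N G) e) i j k l"
      by (auto simp: obeys_model_first_iff[OF N])
    have "orth k j l i" if "i < j" "j < k" "k < l" "l \<le> N" for i j k l
      using cond[rule_format, of i j k l] that
      by (simp add: model_cov_eq[OF model_mat_first_unitriangular e inn] cov_condition_cov_bmat)
    then show "reciprocal M N x"
      by (rule reciprocal_if_first[OF e inn])
  qed
qed

end

theorem theorem4p4:
  fixes M :: "'a measure" and N :: nat and x :: "nat \<Rightarrow> 'a \<Rightarrow> real^'d"
  assumes "prob_space M"
    and "zero_mean_gaussian_seq M N x"
  shows "(reciprocal M N x \<longleftrightarrow>
           (\<exists>G e. zero_mean_white_gaussian_seq M N e \<and> obeys_model M N N G e x \<and>
              (\<forall>i\<in>{0..N}. \<forall>j\<in>{0..N}. \<forall>k\<in>{0..N}. \<forall>l\<in>{0..N}. l < i \<and> i < j \<and> j < k \<longrightarrow>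
                 cov_condition (model_cov M N (model_mat_last N G) e) i j k l))) \<and>
         (reciprocal M N x \<longleftrightarrow>
           (\<exists>G e. zero_mean_white_gaussian_seq M N e \<and> obeys_model M N 0 G e x \<and>
              (\<forall>i\<in>{0..N}. \<forall>j\<in>{0..N}. \<forall>k\<in>{0..N}. \<forall>l\<in>{0..N}. i < j \<and> j < k \<and> k < l \<longrightarrow>
                 cov_condition (model_cov M N (model_mat_first N G) e) i j k l)))"
proof -
  interpret gaussian_seq M N x
    using assms by (simp add: gaussian_seq_def gaussian_seq_axioms_def)
  show ?thesis
    using reciprocal_iff_last reciprocal_iff_first by (rule conjI)
qed

end
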